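(* Let $q,a$ be complex numbers with $0<|q|<1$, $a\neq 0$ and $a\notin\{q^m: m\in\mathbb{Z}\}$, and fix a square root $q^{1/2}$ of $q$. Let $k$ be a positive integer, put $\kappa=2k-1/2$ and, for nonnegative integers $n_1,\dots,n_{k-1}$, $N_j=n_j+n_{j+1}+\cdots+n_{k-1}$. Then $$\sum_{n=0}^{\infty}\frac{(q;q)_{2n}\, q^n}{(a;q)_{n+1}(q/a;q)_n}\sum_{n_1,\dots,n_{k-1}=0}^{\infty}\frac{q^{N_1^2+\cdots+N_{k-1}^2+N_1+\cdots+N_{k-1}}}{(q;q)_{n-N_1}(q;q)_{n_1}\cdots(q;q)_{n_{k-1}}(-q^{1/2};q^{1/2})_{2n_{k-1}}}$$ $$=\sum_{n=0}^{\infty} a^n q^{(\kappa-1)\binom{n+1}{2}}+\sum_{i=1}^{2k-1} (-1)^{i+1} a^i q^{\binom{i}{2}}\frac{(q^i,q^{\kappa-i},q^{\kappa};q^{\kappa})_{\infty}}{(q,a,q/a;q)_{\infty}}$$ $$\qquad\times\sum_{n=0}^{\infty} (-1)^n a^{2\kappa n}q^{2(\kappa-1)(\kappa n+i)n}\bigl(1+a^{2\kappa-2i}q^{2(\kappa-1)(\kappa-i)(2n+1)}\bigr).$$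
   Context: Notation: $(x;q)_\infty=\prod_{j=0}^\infty(1-xq^j)$; $(x;q)_n=(x;q)_\infty/(xq^n;q)_\infty$ for all integers $n$ (so $(x;q)_n=\prod_{j=0}^{n-1}(1-xq^j)$ for $n\ge 0$), and $1/(q;q)_n=0$ for negative $n$; $(x_1,\dots,x_m;q)_n=(x_1;q)_n\cdots(x_m;q)_n$ (also for $n=\infty$). $\binom{i}{2}=i(i-1)/2$. Half-integer powers are $q^{s}=(q^{1/2})^{2s}$ for $2s\in\mathbb Z$. For $k=1$ the inner sum (over $n_1,\dots,n_{k-1}$) is interpreted as $1/\bigl((q;q)_n(-q^{1/2};q^{1/2})_{2n}\bigr)$. *)

theory Defs
  imports "HOL-Analysis.Analysis"
begin

definition qpoch_inf :: "complex \<Rightarrow> complex \<Rightarrow> complex" where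
  "qpoch_inf x q = (\<Prod>j. 1 - x * q ^ j)"

text \<open>
  The quotient is the intended one only if its denominator does not vanish;
  \<open>qpoch_nat\<close> below shows that it then is the usual finite product.
\<close>

definition qpoch :: "complex \<Rightarrow> complex \<Rightarrow> int \<Rightarrow> complex" where
  "qpoch x q n = qpoch_inf x q / qpoch_inf (x * q powi n) q"

text \<open>The reciprocal of \<open>(q;q)\<^sub>n\<close>, with the convention that it is 0 for negative \<open>n\<close>.\<close>

definition inv_qq :: "complex \<Rightarrow> int \<Rightarrow> complex" where
  "inv_qq q n = (if n < 0 then 0 else 1 / qpoch q q n)"

text \<open>
  The power \<open>q\<^sup>s = r\<^bsup>2s\<^esup>\<close>, where \<open>r\<close> is the chosen square root of \<open>q\<close>. It is
  meaningful only if \<open>2s\<close> is an integer, in which case the floor does nothing.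
\<close>

definition half_pow :: "complex \<Rightarrow> real \<Rightarrow> complex" where
  "half_pow r s = r powi \<lfloor>2 * s\<rfloor>"

definition kappa :: "nat \<Rightarrow> real" where
  "kappa k = 2 * real k - 1/2"

text \<open>A tuple \<open>(n\<^sub>1, \<dots>, n\<^bsub>k-1\<^esub>)\<close> is a function on \<open>{1..k-1}\<close>.\<close>

definition tail_sum :: "nat \<Rightarrow> (nat \<Rightarrow> nat) \<Rightarrow> nat \<Rightarrow> nat" where
  "tail_sum k ns j = (\<Sum>l=j..k-1. ns l)"

definition inner_term :: "complex \<Rightarrow> complex \<Rightarrow> nat \<Rightarrow> nat \<Rightarrow> (nat \<Rightarrow> nat) \<Rightarrow> complex" where
  "inner_term q r k n ns =
     q ^ ((\<Sum>j=1..k-1. (tail_sum k ns j)\<^sup>2) + (\<Sum>j=1..k-1. tail_sum k ns j))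
     * inv_qq q (int n - int (tail_sum k ns 1))
     / ((\<Prod>j=1..k-1. qpoch q q (int (ns j))) * qpoch (- r) r (2 * int (ns (k - 1))))"

definition inner_sum :: "complex \<Rightarrow> complex \<Rightarrow> nat \<Rightarrow> nat \<Rightarrow> complex" where
  "inner_sum q r k n =
     (if k = 1 then 1 / (qpoch q q (int n) * qpoch (- r) r (2 * int n))
      else (\<Sum>\<^sub>\<infinity>ns \<in> {1..k-1} \<rightarrow>\<^sub>E UNIV. inner_term q r k n ns))"

definition lhs_term :: "complex \<Rightarrow> complex \<Rightarrow> complex \<Rightarrow> nat \<Rightarrow> nat \<Rightarrow> complex" where
  "lhs_term q r a k n =
     qpoch q q (2 * int n) * q ^ n / (qpoch a q (int n + 1) * qpoch (q / a) q (int n))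
     * inner_sum q r k n"

definition partial_theta_term :: "complex \<Rightarrow> complex \<Rightarrow> nat \<Rightarrow> nat \<Rightarrow> complex" where
  "partial_theta_term r a k n = a ^ n * half_pow r ((kappa k - 1) * real ((n + 1) choose 2))"

definition prod_factor :: "complex \<Rightarrow> complex \<Rightarrow> complex \<Rightarrow> nat \<Rightarrow> nat \<Rightarrow> complex" where
  "prod_factor q r a k i =
     (let Q = half_pow r (kappa k)
      in qpoch_inf (q ^ i) Q * qpoch_inf (half_pow r (kappa k - real i)) Q * qpoch_inf Q Q
         / (qpoch_inf q q * qpoch_inf a q * qpoch_inf (q / a) q))"

text \<open>
  The exponents \<open>2\<kappa>n\<close> and \<open>2\<kappa> - 2i\<close> of \<open>a\<close> are integers, since \<open>2\<kappa> = 4k - 1\<close>; the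
  floors only convert their type.
\<close>

definition rhs_term :: "complex \<Rightarrow> complex \<Rightarrow> nat \<Rightarrow> nat \<Rightarrow> nat \<Rightarrow> complex" where
  "rhs_term r a k i n =
     (- 1) ^ n * a powi \<lfloor>2 * kappa k * real n\<rfloor>
     * half_pow r (2 * (kappa k - 1) * (kappa k * real n + real i) * real n)
     * (1 + a powi \<lfloor>2 * kappa k - 2 * real i\<rfloor>
            * half_pow r (2 * (kappa k - 1) * (kappa k - real i) * (2 * real n + 1)))"

lemma qpoch_inf_convergent:
  fixes x q :: complex
  assumes "norm q < 1"
  shows "convergent_prod (\<lambda>j. 1 - x * q ^ j)"
proof -
  have "summable (\<lambda>j. norm ((1 - x * q ^ j) - 1))"
    using summable_mult[OF summable_geometric[of "norm q"], of "norm x"] assms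
    by (simp add: norm_mult norm_power)
  then show ?thesis
    by (intro abs_convergent_prod_imp_convergent_prod summable_imp_abs_convergent_prod)
qed

lemma qpoch_nat:
  assumes "norm q < 1" and "qpoch_inf (x * q ^ n) q \<noteq> 0"
  shows "qpoch x q (int n) = (\<Prod>j<n. 1 - x * q ^ j)"
proof -
  note conv = qpoch_inf_convergent[OF assms(1), of x]
  have "qpoch_inf x q = (\<Prod>j<n. 1 - x * q ^ j) * qpoch_inf (x * q ^ n) q"
  proof (cases "\<exists>j<n. 1 - x * q ^ j = 0")
    case True
    then have "0 \<in> range (\<lambda>j. 1 - x * q ^ j)"
      by (metis rangeI)
    then have "qpoch_inf x q = 0"
      using has_prod_eq_0_iff[OF convergent_prod_has_prod[OF conv]] by (simp add: qpoch_inf_def)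
    then show ?thesis
      using True by auto
  next
    case False
    then show ?thesis
      using prodinf_split_initial_segment[OF conv, of n]
      unfolding qpoch_inf_def by (simp add: power_add mult_ac)
  qed
  then show ?thesis
    using assms(2) by (simp add: qpoch_def)
qed

lemma inner_term_summable: "inner_term q r k n summable_on ({1..k-1} \<rightarrow>\<^sub>E UNIV)"
proof -
  have "inner_term q r k n ns = 0"
    if "ns \<in> ({1..k-1} \<rightarrow>\<^sub>E UNIV) - ({1..k-1} \<rightarrow>\<^sub>E {..n})" for ns
  proof -
    from that have "\<exists>j\<in>{1..k-1}. \<not> ns j \<le> n"
      by (auto simp: PiE_iff)
    then obtain j where j: "j \<in> {1..k-1}" "ns j > n"
      using not_le by blast
    then have "ns j \<le> tail_sum k ns 1"
      unfolding tail_sum_def by (intro member_le_sum) auto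
    then show ?thesis
      using j by (simp add: inner_term_def inv_qq_def)
  qed
  moreover have "inner_term q r k n summable_on ({1..k-1} \<rightarrow>\<^sub>E {..n})"
    by (intro summable_on_finite finite_PiE) auto
  ultimately show ?thesis
    using summable_on_cong_neutral[of "{1..k-1} \<rightarrow>\<^sub>E {..n}" "{1..k-1} \<rightarrow>\<^sub>E UNIV"
        "inner_term q r k n" "inner_term q r k n"] PiE_mono[of "{1..k-1}" "\<lambda>_. {..n}" "\<lambda>_. UNIV"]
    by blast
qed

end

theory Submission
  imports Defs
begin

text \<open>
  Write \<open>\<theta>(x) = \<Sum>\<^bsub>m\<ge>0\<^esub> (-1)\<^sup>m q\<^bsup>m(m-1)/2\<^esup> x\<^sup>m\<close>, \<open>K = 2\<kappa> = 4k - 1\<close>, \<open>Q = q\<^sup>\<kappa> = r\<^sup>K\<close> and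
  \<open>P = (q, a, q/a; q)\<^sub>\<infinity>\<close>. The inner sum is the end of a Bailey chain relative to \<open>q\<close>, so after
  multiplication by \<open>P\<close> and exchange of the summations the left-hand side becomes
  \<open>\<Sum>\<^sub>n (-1)\<^sup>n Q\<^bsup>n(n+1)/2\<^esup> (\<theta>(aq\<^bsup>n+1\<^esup>) + \<theta>(q\<^bsup>n+1\<^esup>/a) - 1)\<close>, where the sum over the difference of
  the two indices is evaluated by Warnaar's partial theta identity.

  The Jacobi triple product at \<open>a q\<^bsup>-n\<^esup>\<close> replaces \<open>\<theta>(aq\<^bsup>n+1\<^esup>) + \<theta>(q\<^bsup>n+1\<^esup>/a) - 1\<close> by a multiple
  of \<open>P\<close>, which yields the partial theta function, minus \<open>\<theta>(aq\<^bsup>-n\<^esup>) - \<theta>(aq\<^bsup>n+1\<^esup>)\<close>. Exchanging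
  summations once more, the triple product to base \<open>Q\<close> turns the second part into
  \<open>\<Sum>\<^sub>m (-1)\<^sup>m q\<^bsup>m(m-1)/2\<^esup> a\<^sup>m (q\<^sup>m, Q/q\<^sup>m, Q; Q)\<^sub>\<infinity>\<close>. Since \<open>q\<^sup>K = Q\<^sup>2\<close>, these products are
  quasi-periodic in \<open>m\<close> with period \<open>K\<close>; they vanish if \<open>K\<close> divides \<open>m\<close>, and the residues
  \<open>i\<close> and \<open>K - i\<close> together give the \<open>i\<close>-th term of the right-hand side.
\<close>

section \<open>Finite and infinite q-shifted factorials\<close>

text \<open>\<open>qpoch\<close> is a quotient of infinite products and means the intended thing
  only where its denominator does not vanish. The plain finite product is used for all calculations;
  \<open>qpoch_eq_qfac\<close> translates.\<close>

definition qfac :: "complex \<Rightarrow> complex \<Rightarrow> nat \<Rightarrow> complex" where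
  "qfac x q n = (\<Prod>j<n. 1 - x * q ^ j)"

lemma qfac_0 [simp]: "qfac x q 0 = 1"
  by (simp add: qfac_def)

lemma qfac_Suc: "qfac x q (Suc n) = qfac x q n * (1 - x * q ^ n)"
  by (simp add: qfac_def)

lemma qfac_add: "qfac x q (m + n) = qfac x q m * qfac (x * q ^ m) q n"
  by (induction n) (simp_all add: qfac_Suc power_add mult_ac)

lemma qfac_eq_0_iff: "qfac x q n = 0 \<longleftrightarrow> (\<exists>j<n. x * q ^ j = 1)"
  by (auto simp: qfac_def)

lemma qfac_q_nonzero:
  fixes q :: complex
  assumes "norm q < 1"
  shows "qfac q q n \<noteq> 0"
proof -
  have "norm (q * q ^ j) < 1" for j
    using power_Suc_less_one[of "norm q" j] assms power_less_one_iff[of "norm q" "Suc j"]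
    by (simp add: norm_mult norm_power flip: power_Suc)
  then show ?thesis
    by (metis qfac_eq_0_iff norm_one less_irrefl)
qed

lemma qpoch_inf_split:
  fixes x q :: complex
  assumes "norm q < 1"
  shows "qpoch_inf x q = qfac x q n * qpoch_inf (x * q ^ n) q"
proof -
  note conv = qpoch_inf_convergent[OF assms, of x]
  show ?thesis
  proof (cases "\<exists>j<n. 1 - x * q ^ j = 0")
    \<comment> \<open>A vanishing initial factor makes both sides 0; the library rule for splitting
      off an initial segment covers only nonzero initial factors.\<close>
    case True
    then have "0 \<in> range (\<lambda>j. 1 - x * q ^ j)"
      by (metis rangeI)
    then have "qpoch_inf x q = 0"
      using has_prod_eq_0_iff[OF convergent_prod_has_prod[OF conv]] by (simp add: qpoch_inf_def)
    then show ?thesis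
      using True by (auto simp: qfac_def)
  next
    case False
    then show ?thesis
      using prodinf_split_initial_segment[OF conv, of n]
      unfolding qpoch_inf_def qfac_def by (simp add: power_add mult_ac)
  qed
qed

section \<open>Limits, zeros and uniform bounds of q-shifted factorials\<close>

lemma qfac_tendsto:
  fixes x q :: complex
  assumes "norm q < 1"
  shows "qfac x q \<longlonglongrightarrow> qpoch_inf x q"
proof -
  have "(\<lambda>n. \<Prod>j\<le>n. 1 - x * q ^ j) \<longlonglongrightarrow> qpoch_inf x q"
    unfolding qpoch_inf_def by (rule convergent_prod_LIMSEQ[OF qpoch_inf_convergent[OF assms]])
  then have "(\<lambda>n. qfac x q (Suc n)) \<longlonglongrightarrow> qpoch_inf x q"
    by (simp add: qfac_def lessThan_Suc_atMost)
  then show ?thesis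
    by (rule LIMSEQ_imp_Suc)
qed

lemma qpoch_inf_eq_0_iff:
  fixes x q :: complex
  assumes "norm q < 1"
  shows "qpoch_inf x q = 0 \<longleftrightarrow> (\<exists>j. x * q ^ j = 1)"
  using has_prod_eq_0_iff[OF convergent_prod_has_prod[OF qpoch_inf_convergent[OF assms, of x]]]
  by (auto simp: qpoch_inf_def image_iff)

lemma qpoch_inf_q_nonzero:
  fixes q :: complex
  assumes "norm q < 1"
  shows "qpoch_inf q q \<noteq> 0"
  using qfac_q_nonzero[OF assms] by (metis assms lessI qfac_eq_0_iff qpoch_inf_eq_0_iff)

text \<open>By \<open>1 + t <= exp t\<close> and the geometric series. The bound is uniform in
  \<open>n\<close>, as the domination of double sums requires.\<close>

lemma norm_qfac_le:
  fixes x q :: complex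
  assumes "norm q < 1"
  shows "norm (qfac x q n) \<le> exp (norm x / (1 - norm q))"
proof -
  have "norm (qfac x q n) = (\<Prod>j<n. norm (1 - x * q ^ j))"
    by (simp add: qfac_def prod_norm)
  also have "\<dots> \<le> (\<Prod>j<n. 1 + norm x * norm q ^ j)"
    by (intro prod_mono) (auto intro!: order_trans[OF norm_triangle_ineq4] simp: norm_mult norm_power)
  also have "\<dots> \<le> exp (\<Sum>j<n. norm x * norm q ^ j)"
    by (rule prod_le_exp_sum) simp
  also have "(\<Sum>j<n. norm x * norm q ^ j) \<le> (\<Sum>j. norm x * norm q ^ j)"
    using assms by (intro sum_le_suminf summable_mult summable_geometric) auto
  also have "(\<Sum>j. norm x * norm q ^ j) = norm x / (1 - norm q)"
    using assms by (simp add: suminf_mult suminf_geometric)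
  finally show ?thesis
    by simp
qed

lemma norm_qpoch_inf_le:
  fixes x q :: complex
  assumes "norm q < 1"
  shows "norm (qpoch_inf x q) \<le> exp (norm x / (1 - norm q))"
  by (rule LIMSEQ_le_const2[OF tendsto_norm[OF qfac_tendsto[OF assms]]])
     (use norm_qfac_le[OF assms] in blast)

lemma norm_mult_power_le:
  fixes x q :: complex
  assumes "norm q < 1"
  shows "norm (x * q ^ n) \<le> norm x"
  using assms by (simp add: norm_mult norm_power mult_left_le power_le_one)

lemma norm_qpoch_inf_shift_le:
  fixes x q :: complex
  assumes "norm q < 1"
  shows "norm (qpoch_inf (x * q ^ n) q) \<le> exp (norm x / (1 - norm q))"
  by (rule order_trans[OF norm_qpoch_inf_le[OF assms]])
     (use assms norm_mult_power_le[OF assms, of x n] in \<open>simp add: divide_right_mono\<close>)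

lemma norm_qfac_shift_le:
  fixes x q :: complex
  assumes "norm q < 1"
  shows "norm (qfac (x * q ^ n) q m) \<le> exp (norm x / (1 - norm q))"
  by (rule order_trans[OF norm_qfac_le[OF assms]])
     (use assms norm_mult_power_le[OF assms, of x n] in \<open>simp add: divide_right_mono\<close>)

text \<open>A tail is the full product divided by a finite one. This needs a nonzero full product,
  so the start is first moved to \<open>y = x * q ^ m\<close> of norm below 1.\<close>

lemma qpoch_inf_shift_tendsto_1:
  fixes x q :: complex
  assumes q: "norm q < 1"
  shows "(\<lambda>n. qpoch_inf (x * q ^ n) q) \<longlonglongrightarrow> 1"
proof -
  have "(\<lambda>n. x * q ^ n) \<longlonglongrightarrow> x * 0"
    using q by (intro tendsto_intros LIMSEQ_power_zero)
  then have "eventually (\<lambda>n. norm (x * q ^ n) < 1) sequentially"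
    by (auto dest!: tendstoD[of _ _ _ 1] simp: dist_norm)
  then obtain m where m: "norm (x * q ^ m) < 1"
    by (auto simp: eventually_sequentially)
  define y where "y = x * q ^ m"
  have "norm (y * q ^ j) < 1" for j
    using m norm_mult_power_le[OF q, of y j] by (simp add: y_def)
  then have ne: "qpoch_inf y q \<noteq> 0"
    by (metis qpoch_inf_eq_0_iff[OF q] norm_one less_irrefl)
  have "(\<lambda>n. qpoch_inf y q / qfac y q n) \<longlonglongrightarrow> qpoch_inf y q / qpoch_inf y q"
    by (intro tendsto_intros qfac_tendsto q ne)
  moreover have "qpoch_inf y q / qfac y q n = qpoch_inf (y * q ^ n) q" for n
    using ne qpoch_inf_split[OF q, of y n] by auto
  ultimately have "(\<lambda>n. qpoch_inf (x * q ^ (n + m)) q) \<longlonglongrightarrow> 1"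
    using ne by (simp add: y_def power_add mult_ac)
  then show ?thesis
    by (rule LIMSEQ_offset)
qed

lemma norm_inverse_qfac_bounded:
  fixes x q :: complex
  assumes "norm q < 1" and "\<And>j. x * q ^ j \<noteq> 1"
  obtains C where "C > 0" "\<And>n. norm (inverse (qfac x q n)) \<le> C"
proof -
  have "(\<lambda>n. inverse (qfac x q n)) \<longlonglongrightarrow> inverse (qpoch_inf x q)"
    using assms by (intro tendsto_inverse qfac_tendsto) (simp_all add: qpoch_inf_eq_0_iff)
  then have "Bseq (\<lambda>n. inverse (qfac x q n))"
    by (intro convergent_imp_Bseq convergentI)
  then show ?thesis
    using that by (auto elim: BseqE)
qed

section \<open>Warnaar's partial theta identity\<close>

text \<open>
  With \<open>w = c/q\<close> the coefficient is \<open>(w;q)\<^bsub>2s\<^esub> / ((q;q)\<^sub>s (wq;q)\<^sub>s)\<close>. Splitting off the factor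
  \<open>1 - w\<close>, with a separate clause for \<open>s = 0\<close>, keeps it meaningful at \<open>w = 1\<close>, the case that gives
  the Jacobi triple product.
\<close>

definition warnaar_coeff :: "complex \<Rightarrow> complex \<Rightarrow> nat \<Rightarrow> complex" where
  "warnaar_coeff c q s =
     (if s = 0 then 1 else (1 - c / q) * qfac c q (2 * s - 1) / qfac c q s) / qfac q q s"

text \<open>The quotients of \<open>(a;q)\<close> and \<open>(b;q)\<close> at infinity by their
  values at \<open>s\<close> are written as tails, which keeps the term meaningful when some of
  these factors vanish.\<close>

definition warnaar_term :: "complex \<Rightarrow> complex \<Rightarrow> complex \<Rightarrow> nat \<Rightarrow> complex" where
  "warnaar_term q a b s =
     warnaar_coeff (a * b) q s * q ^ s * qpoch_inf (a * q ^ s) q * qpoch_inf (b * q ^ s) q"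

text \<open>
  Creative telescoping certificate, in the variables \<open>w = ab/q\<close>, \<open>s = a + b\<close> and \<open>u = q\<^sup>n\<close>, for the
  recurrence of the Warnaar sums along \<open>(a, b), (aq, bq), (aq\<^sup>2, bq\<^sup>2)\<close>. Its coefficients were found
  by solving \<open>wz_poly_identity\<close> for the unknown polynomial, degree by degree in \<open>u\<close>.
\<close>

definition wz_poly :: "complex \<Rightarrow> complex \<Rightarrow> complex \<Rightarrow> complex \<Rightarrow> complex" where
  "wz_poly q w s u =
     1 - w * q^2
     + (- s + w + w * q - w * q^2 - w * q^3 + s * w * q^2) * u
     + (w * q - s * w + s * w * q^2 + s * w * q^3 - w^2 * q - w^2 * q^3 + w^2 * q^5
        - s * w^2 * q^5) * u^2
     + (- (w^2 * q) - w^2 * q^2 - w^2 * q^3 - w^2 * q^4 + s * w^2 * q - s * w^2 * q^5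
        + w^3 * q^3 + w^3 * q^4 + w^3 * q^5 + w^3 * q^6) * u^3
     + (s * w^2 * q - w^3 * q^2 + w^3 * q^4 + w^3 * q^6 - s * w^3 * q^3 - s * w^3 * q^4
        + s * w^3 * q^6 - w^4 * q^6) * u^4
     + (- (s * w^3 * q^4) + w^4 * q^4 + w^4 * q^5 - w^4 * q^6 - w^4 * q^7 + s * w^4 * q^6) * u^5
     + (w^4 * q^5 - w^5 * q^7) * u^6"

text \<open>The telescoping equation \<open>T (Suc t) = G (Suc t) - G t\<close> of the recurrence
  proof below, divided by the common factor \<open>M\<close>, with \<open>u = q ^ Suc t\<close>. The
  variables \<open>a\<close>, \<open>b\<close> enter only through
  \<open>(1 - a x)(1 - b x) = 1 - s x + w q x^2\<close>.\<close>

lemma wz_poly_identity: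
  fixes q w s u :: complex
  shows "wz_poly q w s (u * q) * (1 - w * u^2) * (1 - w * u^2 * q)
       - wz_poly q w s u * (1 - u) * (1 - w * u * q^4) * (1 - s * (u * q) + w * q * (u * q)^2)
     = u * ((1 - w) * (1 - w * u * q) * (1 - w * u * q^2) * (1 - w * u * q^3) * (1 - w * u * q^4)
              * (1 - s * u + w * q * u^2) * (1 - s * (u * q) + w * q * (u * q)^2)
          + s * (1 - w * q^2) * (1 - w * u * q^3) * (1 - w * u * q^4) * (1 - w * u^2)
              * (1 - w * u^2 * q) * (1 - s * (u * q) + w * q * (u * q)^2)
          + w * q^2 * (1 - w * q^4) * (1 - w * u^2) * (1 - w * u^2 * q) * (1 - w * u^2 * q^2)
              * (1 - w * u^2 * q^3))"
  unfolding wz_poly_def by algebra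

text \<open>The start \<open>T 0 = G 0\<close> of the telescoping, that is \<open>u = q\<close>,
  after multiplication by \<open>qfac c q 4\<close>.\<close>

lemma wz_poly_initial:
  fixes q w s :: complex
  shows "wz_poly q w s q * (1 - w * q)
     = ((1 - s + w * q) * (1 - s * q + w * q * q^2)
          + s * (1 - s * q + w * q * q^2) + w * q^2)
         * (1 - w * q) * (1 - w * q^2) * (1 - w * q^3) * (1 - w * q^4)"
  unfolding wz_poly_def by algebra

section \<open>Uniform bounds and the recurrence for Warnaar's sums\<close>

lemma norm_warnaar_coeff_bounded:
  fixes c q :: complex
  assumes q: "norm q < 1" and c: "\<And>j. c * q ^ j \<noteq> 1"
  obtains C where "C > 0" "\<And>n s. norm (warnaar_coeff (c * q ^ n) q s) \<le> C"
proof -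
  obtain C1 where C1: "C1 > 0" "\<And>n. norm (inverse (qfac c q n)) \<le> C1"
    using norm_inverse_qfac_bounded[OF q c] by blast
  have qne: "q * q ^ j \<noteq> 1" for j
    using qfac_q_nonzero[OF q, of "Suc j"] by (auto simp: qfac_eq_0_iff)
  obtain C2 where C2: "C2 > 0" "\<And>n. norm (inverse (qfac q q n)) \<le> C2"
    using norm_inverse_qfac_bounded[OF q qne] by blast
  define E where "E = exp (norm c / (1 - norm q))"
  define C where "C = (1 + (1 + norm (c / q)) * E * (E * C1)) * C2"
  have E: "E > 0"
    by (simp add: E_def)
  have "norm (warnaar_coeff (c * q ^ n) q s) \<le> C" for n s
  proof -
    have ne: "qfac c q m \<noteq> 0" for m
      using c by (simp add: qfac_eq_0_iff)
    \<comment> \<open>Rewrites the inverse of a shifted factorial as a bounded product times an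
      inverse whose bound \<open>C1\<close> does not depend on the shift \<open>n\<close>.\<close>
    have shift: "inverse (qfac (c * q ^ n) q s) = qfac c q n * inverse (qfac c q (n + s))"
      using ne by (simp add: qfac_add field_simps)
    have 1: "norm (1 - c * q ^ n / q) \<le> 1 + norm (c / q)"
      using norm_mult_power_le[OF q, of "c / q" n]
      by (intro order_trans[OF norm_triangle_ineq4]) (simp add: norm_divide norm_mult)
    have 2: "norm (inverse (qfac (c * q ^ n) q s)) \<le> E * C1"
      unfolding shift norm_mult E_def
      by (intro mult_mono norm_qfac_le q C1) auto
    have 3: "norm (qfac (c * q ^ n) q (2 * s - 1)) \<le> E"
      unfolding E_def by (rule norm_qfac_shift_le[OF q])
    have 4: "norm ((1 - c * q ^ n / q) * qfac (c * q ^ n) q (2 * s - 1) * inverse (qfac (c * q ^ n) q s))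
        \<le> (1 + norm (c / q)) * E * (E * C1)"
      unfolding norm_mult by (intro mult_mono 1 2 3) (use E in auto)
    have 5: "norm (if s = 0 then 1 else
        (1 - c * q ^ n / q) * qfac (c * q ^ n) q (2 * s - 1) / qfac (c * q ^ n) q s)
        \<le> 1 + (1 + norm (c / q)) * E * (E * C1)"
      using 4 E C1(1) by (auto simp: field_class.field_divide_inverse)
    show ?thesis
      unfolding warnaar_coeff_def C_def field_class.field_divide_inverse[of _ "qfac q q s"] norm_mult[of _ "inverse (qfac q q s)"]
      by (intro mult_mono 5 C2) (use E C1 in auto)
  qed
  moreover have "C > 0"
    using E C1 C2 by (auto simp: C_def intro!: mult_pos_pos add_pos_nonneg)
  ultimately show ?thesis
    using that by blast
qed

lemma norm_warnaar_term_bounded: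
  fixes a b q :: complex
  assumes q: "norm q < 1" and ab: "\<And>j. a * b * q ^ j \<noteq> 1"
  obtains C where "C > 0" "\<And>n s. norm (warnaar_term q (a * q ^ n) (b * q ^ n) s) \<le> C * norm q ^ s"
proof -
  obtain C1 where C1: "C1 > 0" "\<And>n s. norm (warnaar_coeff (a * b * q ^ n) q s) \<le> C1"
    using norm_warnaar_coeff_bounded[OF q ab] by blast
  define A where "A = exp (norm a / (1 - norm q))"
  define B where "B = exp (norm b / (1 - norm q))"
  have "norm (warnaar_term q (a * q ^ n) (b * q ^ n) s) \<le> C1 * norm q ^ s * A * B" for n s
  proof -
    have *: "a * q ^ n * (b * q ^ n) = a * b * q ^ (n + n)" "a * q ^ n * q ^ s = a * q ^ (n + s)"
      "b * q ^ n * q ^ s = b * q ^ (n + s)"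
      by (simp_all add: power_add)
    show ?thesis
      unfolding warnaar_term_def * norm_mult norm_power A_def B_def
      by (intro mult_mono C1 norm_qpoch_inf_shift_le q order_refl) (use C1(1) in auto)
  qed
  then have "norm (warnaar_term q (a * q ^ n) (b * q ^ n) s) \<le> (C1 * A * B) * norm q ^ s" for n s
    by (simp add: mult_ac)
  moreover have "C1 * A * B > 0"
    using C1(1) by (simp add: A_def B_def)
  ultimately show ?thesis
    using that by blast
qed

lemma summable_warnaar_term:
  fixes a b q :: complex
  assumes q: "norm q < 1" and ab: "\<And>j. a * b * q ^ j \<noteq> 1"
  shows "summable (\<lambda>s. norm (warnaar_term q a b s))"
proof -
  obtain C where C: "\<And>n s. norm (warnaar_term q (a * q ^ n) (b * q ^ n) s) \<le> C * norm q ^ s"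
    using norm_warnaar_term_bounded[OF assms] by blast
  have "summable (\<lambda>s. C * norm q ^ s)"
    using q by (intro summable_mult summable_geometric) auto
  then show ?thesis
    by (rule summable_comparison_test'[of _ 0]) (use C[of 0] in simp)
qed

definition warnaar_sum :: "complex \<Rightarrow> complex \<Rightarrow> complex \<Rightarrow> complex" where
  "warnaar_sum q a b = (\<Sum>s. warnaar_term q a b s)"

text \<open>Creative telescoping: the combined summand \<open>T\<close> is the difference of
  consecutive values of the certificate \<open>G\<close>, and \<open>T 0 = G 0\<close>, so the sum
  is the limit of \<open>G\<close>.\<close>

lemma warnaar_sum_recurrence:
  fixes a b q :: complex
  assumes q: "norm q < 1" "q \<noteq> 0" and ab: "\<And>j. a * b * q ^ j \<noteq> 1"
  shows "warnaar_sum q a b + (a + b) * warnaar_sum q (a * q) (b * q)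
           + a * b * q * warnaar_sum q (a * q^2) (b * q^2) = (1 - a * b * q) / qpoch_inf q q"
proof -
  define c where "c = a * b"
  define w where "w = c / q"
  have wq: "c = w * q"
    using q by (simp add: w_def)
  have ne: "qfac c q m \<noteq> 0" for m
    using ab by (simp add: qfac_eq_0_iff c_def)
  note qne = qfac_q_nonzero[OF q(1)]
  let ?P = "\<lambda>x. qpoch_inf x q"
  let ?p = "wz_poly q w (a + b)"
  have P: "?P (x * q ^ n) = (1 - x * q ^ n) * ?P (x * q ^ Suc n)" for x n
    using qpoch_inf_split[OF q(1), of "x * q ^ n" 1] by (simp add: qfac_def mult_ac)
  define G where "G t = ?p (q ^ Suc t) * qfac c q (2 * t + 1) * ?P (a * q ^ (t + 2)) * ?P (b * q ^ (t + 2))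
                         / (qfac c q (t + 4) * qfac q q t)" for t
  define T where "T s = warnaar_term q a b s + (a + b) * warnaar_term q (a * q) (b * q) s
                   + a * b * q * warnaar_term q (a * q^2) (b * q^2) s" for s
  have shift: "qfac (c * q ^ m) q n = qfac c q (m + n) / qfac c q m" for m n
    using ne[of m] by (simp add: qfac_add)
  have T_Suc: "T (Suc t) = G (Suc t) - G t" for t
  proof -
    define u where "u = q ^ Suc t"
    \<comment> \<open>The common factor of the three summands and of both values of
      \<open>G\<close>; what remains next to it is polynomial and is settled by
      \<open>wz_poly_identity\<close>.\<close>
    define M where "M = qfac c q (2 * t + 1) * ?P (a * q ^ (t + 3)) * ?P (b * q ^ (t + 3))
                         / (qfac c q (t + 5) * qfac q q (Suc t))"
    have Px: "?P (x * u) = (1 - x * u) * (1 - x * (u * q)) * ?P (x * q ^ (t + 3))"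
         "?P (x * q ^ (t + 2)) = (1 - x * (u * q)) * ?P (x * q ^ (t + 3))" for x
      using P[of x "Suc t"] P[of x "Suc (Suc t)"] by (simp_all add: u_def mult_ac eval_nat_numeral)
    have c5: "qfac c q (t + 5) = qfac c q (t + 4) * (1 - w * u * q ^ 4)"
      "qfac c q (t + 4) = qfac c q (t + 3) * (1 - w * u * q ^ 3)"
      "qfac c q (t + 3) = qfac c q (t + 2) * (1 - w * u * q ^ 2)"
      "qfac c q (t + 2) = qfac c q (Suc t) * (1 - w * u * q)"
      by (simp_all add: wq u_def qfac_Suc eval_nat_numeral mult_ac power_add)
    have c5': "qfac c q (t + 4) * (1 - w * u * q ^ 4) \<noteq> 0"
       "qfac c q (t + 3) * (1 - w * u * q ^ 3) \<noteq> 0"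
       "qfac c q (t + 2) * (1 - w * u * q ^ 2) \<noteq> 0"
       "qfac c q (Suc t) * (1 - w * u * q) \<noteq> 0"
      unfolding c5[symmetric] by (rule ne)+
    have u2: "u\<^sup>2 = q ^ (2 * t + 2)"
      by (simp add: u_def power_mult power_add eval_nat_numeral algebra_simps flip: power_mult_distrib)
    have c2: "qfac c q (2 * t + 2) = qfac c q (2 * t + 1) * (1 - w * u\<^sup>2)"
      "qfac c q (2 * t + 3) = qfac c q (2 * t + 2) * (1 - w * u\<^sup>2 * q)"
      "qfac c q (2 * t + 4) = qfac c q (2 * t + 3) * (1 - w * u\<^sup>2 * q ^ 2)"
      "qfac c q (2 * t + 5) = qfac c q (2 * t + 4) * (1 - w * u\<^sup>2 * q ^ 3)"
      unfolding u2 by (simp_all add: wq qfac_Suc eval_nat_numeral mult_ac power_add)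
    have 1: "warnaar_term q a b (Suc t) = M * (u * ((1 - w) * (1 - w * u * q) * (1 - w * u * q^2)
        * (1 - w * u * q^3) * (1 - w * u * q^4) * ((1 - a * u) * (1 - b * u))
        * ((1 - a * (u * q)) * (1 - b * (u * q)))))"
      unfolding warnaar_term_def warnaar_coeff_def M_def c5 u_def[symmetric] Px
      using c5' by (simp add: c_def[symmetric] w_def[symmetric] u_def[symmetric])
    have 2: "warnaar_term q (a * q) (b * q) (Suc t) = M * (u * ((1 - w * q^2) * (1 - w * u * q^3)
        * (1 - w * u * q^4) * (1 - w * u^2) * (1 - w * u^2 * q)
        * ((1 - a * (u * q)) * (1 - b * (u * q)))))"
      proof -
      have e1: "warnaar_coeff (a * q * (b * q)) q (Suc t)
          = (1 - w * q^2) * qfac c q (2 * t + 3) / qfac c q (t + 3) / qfac q q (Suc t)"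
        using shift[of 2 "2 * t + 1"] shift[of 2 "Suc t"] ne[of 2] q(2)
        by (simp add: warnaar_coeff_def c_def w_def power2_eq_square mult_ac eval_nat_numeral)
      have e2: "a * q * u = a * (u * q)" "b * q * u = b * (u * q)"
        by (simp_all add: u_def mult_ac)
      have e3: "?P (x * (u * q)) = (1 - x * (u * q)) * ?P (x * q ^ (t + 3))" for x
        using Px(2)[of x] by (simp add: u_def mult_ac eval_nat_numeral)
      show ?thesis
        unfolding warnaar_term_def M_def e1 e2 e3 c5(1,2) c2(1,2) u_def[symmetric]
        using c5' by simp
    qed
    have 3: "warnaar_term q (a * q^2) (b * q^2) (Suc t) = M * (u * ((1 - w * q^4) * (1 - w * u^2) 
        * (1 - w * u^2 * q) * (1 - w * u^2 * q^2) * (1 - w * u^2 * q^3)))"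
      proof -
      have e1: "warnaar_coeff (a * q^2 * (b * q^2)) q (Suc t)
          = (1 - w * q^4) * qfac c q (2 * t + 5) / qfac c q (t + 5) / qfac q q (Suc t)"
        using shift[of 4 "2 * t + 1"] shift[of 4 "Suc t"] ne[of 4] q(2)
        by (simp add: warnaar_coeff_def c_def w_def mult_ac eval_nat_numeral)
      have e2: "a * q^2 * u = a * q ^ (t + 3)" "b * q^2 * u = b * q ^ (t + 3)"
        by (simp_all add: u_def power_add eval_nat_numeral mult_ac)
      show ?thesis
        unfolding warnaar_term_def M_def e1 e2 c2 u_def[symmetric] by simp
    qed
    have 4: "G (Suc t) = M * (?p (u * q) * (1 - w * u^2) * (1 - w * u^2 * q))"
      unfolding G_def M_def using c2 by (simp add: u_def eval_nat_numeral mult_ac)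
    have 5: "G t = M * (?p u * (1 - u) * (1 - w * u * q ^ 4) * ((1 - a * (u * q)) * (1 - b * (u * q))))"
      proof -
      have "qfac q q (Suc t) = qfac q q t * (1 - u)"
        by (simp add: qfac_Suc u_def)
      then show ?thesis
        unfolding G_def M_def Px c5(1) u_def[symmetric] using c5' qne[of t] qne[of "Suc t"] by simp
    qed
    have 6: "(1 - a * x) * (1 - b * x) = 1 - (a + b) * x + w * q * x\<^sup>2" for x
      unfolding wq[symmetric] c_def by (simp add: algebra_simps power2_eq_square)
    have 7: "a * b * q = w * q\<^sup>2"
      using wq by (simp add: c_def power2_eq_square)
    have comb: "M * (u * X) + y * (M * (u * Y)) + z * (M * (u * Z)) = M * (u * (X + y * Y + z * Z))"
      for X Y Z y z
      by (simp add: algebra_simps)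
    have "T (Suc t) = M * (?p (u * q) * (1 - w * u\<^sup>2) * (1 - w * u\<^sup>2 * q)
       - ?p u * (1 - u) * (1 - w * u * q ^ 4) * (1 - (a + b) * (u * q) + w * q * (u * q)\<^sup>2))"
      unfolding wz_poly_identity T_def 1 2 3 6 7 comb by (simp only: mult.assoc)
    also have "\<dots> = G (Suc t) - G t"
      unfolding 4 5 6 by (simp only: mult.assoc right_diff_distrib)
    finally show ?thesis .
  qed
  have T_0: "T 0 = G 0"
    proof -
    have Px: "?P x = (1 - x) * (1 - x * q) * ?P (x * q\<^sup>2)" "?P (x * q) = (1 - x * q) * ?P (x * q\<^sup>2)" for x
      using P[of x 0] P[of x 1] by (simp_all add: mult_ac eval_nat_numeral)
    have c4: "qfac c q 4 = (1 - w * q) * (1 - w * q^2) * (1 - w * q^3) * (1 - w * q^4)"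
      by (simp add: qfac_def wq eval_nat_numeral mult_ac)
    have 6: "(1 - a * x) * (1 - b * x) = 1 - (a + b) * x + w * q * x\<^sup>2" for x
      unfolding wq[symmetric] c_def by (simp add: algebra_simps power2_eq_square)
    have "T 0 = ((1 - a) * (1 - b) * ((1 - a * q) * (1 - b * q))
        + (a + b) * ((1 - a * q) * (1 - b * q)) + a * b * q) * (?P (a * q\<^sup>2) * ?P (b * q\<^sup>2))"
      by (simp add: T_def warnaar_term_def warnaar_coeff_def Px(1)[of a] Px(1)[of b] Px(2) distrib_right)
    also have "(1 - a) * (1 - b) * ((1 - a * q) * (1 - b * q))
        + (a + b) * ((1 - a * q) * (1 - b * q)) + a * b * q = ?p q * (1 - w * q) / qfac c q 4"
    proof -
      have *: "a * b * q = w * q\<^sup>2"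
        using wq by (simp add: c_def power2_eq_square)
      have "(1 - a) * (1 - b) = 1 - (a + b) + w * q"
        using 6[of 1] by simp
      then show ?thesis
        using wz_poly_initial[of q w "a + b"] ne[of 4] unfolding 6 * c4
        by (simp add: nonzero_eq_divide_eq mult.assoc)
    qed
    also have "?p q * (1 - w * q) / qfac c q 4 * (?P (a * q\<^sup>2) * ?P (b * q\<^sup>2)) = G 0"
      by (simp add: G_def qfac_Suc wq power2_eq_square)
    finally show ?thesis .
  qed
  have G_lim: "G \<longlonglongrightarrow> (1 - a * b * q) / qpoch_inf q q"
    proof -
    \<comment> \<open>Only the constant coefficient \<open>1 - w q^2 = 1 - a b q\<close> of the
      certificate survives in the limit \<open>u = 0\<close>; the two factors
      \<open>qfac c q\<close> tend to the same nonzero limit and cancel.\<close>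
    have "(\<lambda>t. ?p (q ^ Suc t)) \<longlonglongrightarrow> ?p 0"
      unfolding wz_poly_def
      by (intro tendsto_intros LIMSEQ_Suc LIMSEQ_power_zero q)
    moreover have "qpoch_inf c q \<noteq> 0"
      using ab by (simp add: qpoch_inf_eq_0_iff[OF q(1)] c_def)
    moreover have "filterlim (\<lambda>t. 2 * t + 1 :: nat) at_top sequentially" "filterlim (\<lambda>t. t + k :: nat) at_top sequentially" for k
      by (auto intro!: filterlim_subseq simp: strict_mono_def)
    moreover have "(\<lambda>t. ?P (x * q ^ (t + 2))) \<longlonglongrightarrow> 1" for x
      by (rule LIMSEQ_ignore_initial_segment[OF qpoch_inf_shift_tendsto_1[OF q(1)]])
    ultimately have "G \<longlonglongrightarrow> ?p 0 * qpoch_inf c q * 1 * 1 / (qpoch_inf c q * qpoch_inf q q)"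
      unfolding G_def
      by (intro tendsto_mult tendsto_divide filterlim_compose[OF qfac_tendsto[OF q(1)]]
           qfac_tendsto q no_zero_divisors qpoch_inf_q_nonzero)
    then show ?thesis
      using \<open>qpoch_inf c q \<noteq> 0\<close> wq by (simp add: wz_poly_def c_def power2_eq_square mult.assoc)
  qed
  have "(\<lambda>t. T (Suc t)) sums ((1 - a * b * q) / qpoch_inf q q - G 0)"
    unfolding T_Suc by (rule telescope_sums[OF G_lim])
  then have "T sums ((1 - a * b * q) / qpoch_inf q q)"
    by (simp add: sums_Suc_iff T_0)
  moreover have "T sums (warnaar_sum q a b + (a + b) * warnaar_sum q (a * q) (b * q)
           + a * b * q * warnaar_sum q (a * q^2) (b * q^2))"
    proof -
    have "summable (\<lambda>s. warnaar_term q (a * q ^ n) (b * q ^ n) s)" for n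
    proof (rule summable_norm_cancel, rule summable_warnaar_term[OF q(1)])
      show "a * q ^ n * (b * q ^ n) * q ^ j \<noteq> 1" for j
        using ab[of "n + n + j"] by (simp add: power_add mult.assoc mult.left_commute)
    qed
    from this[of 0] this[of 1] this[of 2] show ?thesis
      unfolding T_def warnaar_sum_def
      by (intro sums_add sums_mult summable_sums) simp_all
  qed
  ultimately show ?thesis
    by (rule sums_unique2[symmetric])
qed

section \<open>Partial theta series and the proof of Warnaar's identity\<close>

lemma choose_two_Suc: "Suc m choose 2 = (m choose 2) + m"
  by (simp add: numeral_2_eq_2)

text \<open>Ratio test: consecutive terms have quotient \<open>c ^ m * y\<close>, which tends to 0.
  This is the common comparison series for all theta-like sums below.\<close>

lemma summable_power_choose_two:
  fixes c y :: real
  assumes "0 \<le> c" "c < 1" "0 \<le> y"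
  shows "summable (\<lambda>m. c ^ (m choose 2) * y ^ m)"
proof -
  have "(\<lambda>m. c ^ m * y) \<longlonglongrightarrow> 0 * y"
    using assms by (intro tendsto_intros LIMSEQ_power_zero) auto
  then have "eventually (\<lambda>m. c ^ m * y < 1/2) sequentially"
    by (intro order_tendstoD) auto
  then obtain N where N: "\<And>m. m \<ge> N \<Longrightarrow> c ^ m * y < 1/2"
    by (auto simp: eventually_sequentially)
  show ?thesis
  proof (rule summable_ratio_test[of "1/2" N])
    fix m assume "m \<ge> N"
    have "norm (c ^ (Suc m choose 2) * y ^ Suc m) = (c ^ m * y) * norm (c ^ (m choose 2) * y ^ m)"
      using assms by (simp add: choose_two_Suc power_add abs_mult)
    also have "\<dots> \<le> 1/2 * norm (c ^ (m choose 2) * y ^ m)"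
      using N[OF \<open>m \<ge> N\<close>] by (intro mult_right_mono) auto
    finally show "norm (c ^ (Suc m choose 2) * y ^ Suc m) \<le> 1/2 * norm (c ^ (m choose 2) * y ^ m)" .
  qed simp
qed

definition ptheta :: "complex \<Rightarrow> complex \<Rightarrow> complex" where
  "ptheta q x = (\<Sum>m. (-1) ^ m * q ^ (m choose 2) * x ^ m)"

lemma summable_norm_ptheta:
  fixes q x :: complex
  assumes "norm q < 1"
  shows "summable (\<lambda>m. norm ((-1) ^ m * q ^ (m choose 2) * x ^ m))"
  using summable_power_choose_two[of "norm q" "norm x"] assms
  by (simp add: norm_mult norm_power)

lemma ptheta_sums:
  fixes q x :: complex
  assumes "norm q < 1"
  shows "(\<lambda>m. (-1) ^ m * q ^ (m choose 2) * x ^ m) sums ptheta q x"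
  unfolding ptheta_def by (rule summable_sums[OF summable_norm_cancel[OF summable_norm_ptheta[OF assms]]])

lemma ptheta_shift:
  fixes q x :: complex
  assumes "norm q < 1"
  shows "ptheta q x = 1 - x * ptheta q (x * q)"
proof -
  let ?f = "\<lambda>m. (-1) ^ m * q ^ (m choose 2) * x ^ m"
  have "?f (Suc m) = (-x) * ((-1) ^ m * q ^ (m choose 2) * (x * q) ^ m)" for m
    by (simp add: choose_two_Suc power_add power_mult_distrib)
  moreover have "(\<lambda>m. (-x) * ((-1) ^ m * q ^ (m choose 2) * (x * q) ^ m)) sums (-x * ptheta q (x * q))"
    by (intro sums_mult ptheta_sums assms)
  ultimately have "?f sums (-x * ptheta q (x * q) + ?f 0)"
    by (intro sums_Suc) (simp only:)
  from sums_unique2[OF ptheta_sums[OF assms] this] show ?thesis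
    by (simp add: binomial_eq_0)
qed

lemma norm_ptheta_bounded:
  fixes q x :: complex
  assumes "norm q < 1"
  obtains C where "\<And>n. norm (ptheta q (x * q ^ n)) \<le> C"
proof -
  have "norm (ptheta q (x * q ^ n)) \<le> (\<Sum>m. norm q ^ (m choose 2) * norm x ^ m)" for n
    unfolding ptheta_def
  proof (rule norm_suminf_le)
    fix m
    have "norm ((-1) ^ m * q ^ (m choose 2) * y ^ m) = norm q ^ (m choose 2) * norm y ^ m" for y
      by (simp add: norm_mult norm_power)
    then show "norm ((-1) ^ m * q ^ (m choose 2) * (x * q ^ n) ^ m) \<le> norm q ^ (m choose 2) * norm x ^ m"
      using norm_mult_power_le[OF assms, of x n] by (auto intro!: mult_left_mono power_mono)
  next
    show "summable (\<lambda>m. norm q ^ (m choose 2) * norm x ^ m)"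
      using assms by (intro summable_power_choose_two) auto
  qed
  then show ?thesis
    using that by blast
qed

text \<open>Beyond an index \<open>N\<close> the coefficients have total norm below 1/2, so each
  application of the recurrence halves the bound and \<open>d\<close> vanishes there. Since each
  term is determined by the next two, the zeros then propagate back to index 0.\<close>

lemma bounded_recurrence_zero:
  fixes d \<alpha> \<beta> :: "nat \<Rightarrow> complex"
  assumes rec: "\<And>n. d n = \<alpha> n * d (Suc n) + \<beta> n * d (Suc (Suc n))"
    and \<alpha>: "\<alpha> \<longlonglongrightarrow> 0" and \<beta>: "\<beta> \<longlonglongrightarrow> 0"
    and bound: "\<And>n. norm (d n) \<le> M"
  shows "d n = 0"
proof -
  have M: "M \<ge> 0"
    using order_trans[OF norm_ge_zero bound] .
  have "(\<lambda>n. norm (\<alpha> n) + norm (\<beta> n)) \<longlonglongrightarrow> norm (0::complex) + norm (0::complex)"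
    by (intro tendsto_intros \<alpha> \<beta>)
  then have "eventually (\<lambda>n. norm (\<alpha> n) + norm (\<beta> n) < 1/2) sequentially"
    by (intro order_tendstoD) auto
  then obtain N where N: "\<And>m. m \<ge> N \<Longrightarrow> norm (\<alpha> m) + norm (\<beta> m) < 1/2"
    by (auto simp: eventually_sequentially)
  have geom: "\<forall>m\<ge>N. norm (d m) \<le> M * (1/2) ^ k" for k
  proof (induction k)
    case 0
    then show ?case
      using bound by simp
  next
    case (Suc k)
    show ?case
    proof (intro allI impI)
      fix m assume m: "m \<ge> N"
      have "norm (d m) \<le> norm (\<alpha> m) * norm (d (Suc m)) + norm (\<beta> m) * norm (d (Suc (Suc m)))"
        by (subst rec) (auto intro!: order_trans[OF norm_triangle_ineq] simp: norm_mult)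
      also have "\<dots> \<le> norm (\<alpha> m) * (M * (1/2) ^ k) + norm (\<beta> m) * (M * (1/2) ^ k)"
        using Suc m by (intro add_mono mult_left_mono) auto
      also have "\<dots> = (norm (\<alpha> m) + norm (\<beta> m)) * (M * (1/2) ^ k)"
        by (simp add: distrib_right)
      also have "\<dots> \<le> 1/2 * (M * (1/2) ^ k)"
        using N[OF m] M by (intro mult_right_mono) auto
      finally show "norm (d m) \<le> M * (1/2) ^ Suc k"
        by simp
    qed
  qed
  have tail: "d m = 0" if "m \<ge> N" for m
  proof -
    have "(\<lambda>k. M * (1/2) ^ k) \<longlonglongrightarrow> M * 0"
      by (intro tendsto_intros LIMSEQ_power_zero) auto
    then have "norm (d m) \<le> M * 0"
      by (rule LIMSEQ_le_const) (use geom that in blast)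
    then show ?thesis
      by simp
  qed
  have "\<forall>m\<ge>N - k. d m = 0" for k
  proof (induction k)
    case 0
    then show ?case
      using tail by simp
  next
    case (Suc k)
    show ?case
    proof (intro allI impI)
      fix m assume "m \<ge> N - Suc k"
      then show "d m = 0"
        using Suc rec[of m] by (cases "m \<ge> N - k") auto
    qed
  qed
  from this[of N] show ?thesis
    by simp
qed

text \<open>
  Both sides satisfy the same inhomogeneous recurrence along \<open>(aq\<^sup>n, bq\<^sup>n)\<close>. Their difference is
  a bounded solution of the homogeneous recurrence, whose coefficients tend to 0, so it vanishes.
\<close>

theorem warnaar_sum_eq_ptheta:
  fixes a b q :: complex
  assumes q: "norm q < 1" "q \<noteq> 0" and ab: "\<And>j. a * b * q ^ j \<noteq> 1"
  shows "qpoch_inf q q * warnaar_sum q a b = ptheta q a + ptheta q b - 1"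
proof -
  define R where "R n = warnaar_sum q (a * q ^ n) (b * q ^ n)" for n
  define S where "S n = ptheta q (a * q ^ n) + ptheta q (b * q ^ n) - 1" for n
  define d where "d n = qpoch_inf q q * R n - S n" for n
  have q0: "qpoch_inf q q \<noteq> 0"
    using q by (simp add: qpoch_inf_q_nonzero)
  have q2: "q ^ (2 * n + 1) = q ^ n * q ^ n * q" for n
    by (simp add: power_add mult_2)
  have rec_R: "qpoch_inf q q * R n + (a + b) * q ^ n * (qpoch_inf q q * R (Suc n))
       + a * b * q ^ (2 * n + 1) * (qpoch_inf q q * R (Suc (Suc n))) = 1 - a * b * q ^ (2 * n + 1)" for n
  proof -
    have "a * q ^ n * (b * q ^ n) * q ^ j \<noteq> 1" for j
      using ab[of "n + n + j"] by (simp add: power_add mult.assoc mult.left_commute)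
    have shift: "x * q ^ n * q = x * q ^ Suc n" "x * q ^ n * q\<^sup>2 = x * q ^ Suc (Suc n)" for x
      by (simp_all add: mult_ac power2_eq_square)
    have 4: "(a + b) * q ^ n = a * q ^ n + b * q ^ n"
      "a * b * q ^ (2 * n + 1) = a * q ^ n * (b * q ^ n) * q"
      using q2 by (simp_all add: distrib_right)
    from warnaar_sum_recurrence[OF q \<open>\<And>j. a * q ^ n * (b * q ^ n) * q ^ j \<noteq> 1\<close>]
    have "R n + (a * q ^ n + b * q ^ n) * R (Suc n)
       + a * q ^ n * (b * q ^ n) * q * R (Suc (Suc n)) = (1 - a * q ^ n * (b * q ^ n) * q) / qpoch_inf q q"
      unfolding R_def shift .
    then have "qpoch_inf q q * (R n + (a * q ^ n + b * q ^ n) * R (Suc n)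
       + a * q ^ n * (b * q ^ n) * q * R (Suc (Suc n))) = 1 - a * q ^ n * (b * q ^ n) * q"
      using q0 by simp
    then show ?thesis
      unfolding 4 distrib_left by (simp only: mult.left_commute)
  qed
  have rec_S: "S n + (a + b) * q ^ n * S (Suc n) + a * b * q ^ (2 * n + 1) * S (Suc (Suc n))
      = 1 - a * b * q ^ (2 * n + 1)" for n
  proof -
    have th: "ptheta q (x * q ^ n) = 1 - x * q ^ n * ptheta q (x * q ^ Suc n)" for x n
      using ptheta_shift[OF q(1), of "x * q ^ n"] by (simp add: mult_ac)
    define x y x1 y1 where "x = a * q ^ n" and "y = b * q ^ n"
      and "x1 = ptheta q (a * q ^ Suc n)" and "y1 = ptheta q (b * q ^ Suc n)"
    \<comment> \<open>All three values of \<open>S\<close> are expressed through the theta values at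
      index \<open>n + 1\<close>: index \<open>n\<close> by one use of \<open>ptheta_shift\<close>,
      and index \<open>n + 2\<close>, after multiplication by \<open>x * y * q\<close>, by the same
      relation read backwards.\<close>
    have 1: "S n = 1 - x * x1 - y * y1"
      unfolding S_def th[of a n] th[of b n] by (simp add: x_def y_def x1_def y1_def)
    have 2: "S (Suc n) = x1 + y1 - 1"
      by (simp add: S_def x1_def y1_def)
    have "x1 = 1 - x * q * ptheta q (a * q ^ Suc (Suc n))" "y1 = 1 - y * q * ptheta q (b * q ^ Suc (Suc n))"
      unfolding x1_def y1_def x_def y_def by (subst th, simp add: mult_ac)+
    then have 3: "x * y * q * S (Suc (Suc n)) = y * (1 - x1) + x * (1 - y1) - x * y * q"
      unfolding S_def by algebra
    have 4: "(a + b) * q ^ n = x + y" "a * b * q ^ (2 * n + 1) = x * y * q"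
      using q2 by (simp_all add: x_def y_def distrib_right)
    show ?thesis
      unfolding 4 1 2 3 by (simp add: algebra_simps)
  qed
  have rec: "d n = - ((a + b) * q ^ n) * d (Suc n) + - (a * b * q ^ (2 * n + 1)) * d (Suc (Suc n))" for n
  proof -
    have "x - x' = - p * (y - y') + - t * (z - z')"
      if "x + p * y + t * z = k" "x' + p * y' + t * z' = k" for x y z x' y' z' p t k :: complex
    proof -
      have "x = k - p * y - t * z" "x' = k - p * y' - t * z'"
        using that by (simp_all add: eq_diff_eq add_ac)
      then show ?thesis
        by (simp add: algebra_simps)
    qed
    from this[OF rec_R rec_S] show ?thesis
      unfolding d_def .
  qed
  obtain C where C: "\<And>n s. norm (warnaar_term q (a * q ^ n) (b * q ^ n) s) \<le> C * norm q ^ s"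
    using norm_warnaar_term_bounded[OF q(1) ab] by blast
  have R: "norm (R n) \<le> (\<Sum>s. C * norm q ^ s)" for n
    unfolding R_def warnaar_sum_def
    by (rule norm_suminf_le[OF C]) (use q in \<open>intro summable_mult summable_geometric; simp\<close>)
  obtain C1 where C1: "\<And>n. norm (ptheta q (a * q ^ n)) \<le> C1"
    using norm_ptheta_bounded[OF q(1)] by blast
  obtain C2 where C2: "\<And>n. norm (ptheta q (b * q ^ n)) \<le> C2"
    using norm_ptheta_bounded[OF q(1)] by blast
  have "norm (d n) \<le> norm (qpoch_inf q q) * (\<Sum>s. C * norm q ^ s) + (C1 + C2 + 1)" for n
  proof -
    have "norm (S n) \<le> C1 + C2 + 1"
      unfolding S_def
      by (rule order_trans[OF norm_triangle_ineq4])
         (use C1[of n] C2[of n] norm_triangle_ineq[of "ptheta q (a * q ^ n)" "ptheta q (b * q ^ n)"] in simp)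
    then show ?thesis
      unfolding d_def
      by (intro order_trans[OF norm_triangle_ineq4] add_mono) (use R in \<open>auto simp: norm_mult intro: mult_left_mono\<close>)
  qed
  moreover have "(\<lambda>n. - ((a + b) * q ^ n)) \<longlonglongrightarrow> 0"
    using tendsto_minus[OF tendsto_mult[OF tendsto_const LIMSEQ_power_zero[OF q(1)], of "a + b"]] by simp
  moreover have "(\<lambda>n. - (a * b * q ^ (2 * n + 1))) \<longlonglongrightarrow> 0"
  proof -
    have "norm (q\<^sup>2) < 1"
      using q by (simp add: norm_power power_less_one_iff)
    from tendsto_minus[OF tendsto_mult[OF tendsto_const LIMSEQ_power_zero[OF this], of "a * b * q"]]
    show ?thesis
      by (simp add: power_mult mult.assoc)
  qed
  ultimately have "d 0 = 0"
    by (intro bounded_recurrence_zero[where d = d, OF rec])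
  then show ?thesis
    by (simp add: d_def R_def S_def)
qed

text \<open>The case \<open>b = q / z\<close> of Warnaar's identity: here \<open>a b = q\<close>, so
  the factor \<open>1 - c / q\<close> of the coefficient is 0 and only the term \<open>s = 0\<close>
  remains.\<close>

theorem jacobi_triple_product:
  fixes q z :: complex
  assumes q: "norm q < 1" "q \<noteq> 0" and z: "z \<noteq> 0"
  shows "qpoch_inf z q * qpoch_inf (q / z) q * qpoch_inf q q = ptheta q z + ptheta q (q / z) - 1"
proof -
  have "z * (q / z) * q ^ j \<noteq> 1" for j
    using qfac_q_nonzero[OF q(1), of "Suc j"] z by (auto simp: qfac_eq_0_iff)
  from warnaar_sum_eq_ptheta[OF q this]
  have "qpoch_inf q q * warnaar_sum q z (q / z) = ptheta q z + ptheta q (q / z) - 1" .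
  moreover have "warnaar_sum q z (q / z) = (\<Sum>s\<in>{0}. warnaar_term q z (q / z) s)"
    unfolding warnaar_sum_def
    by (rule suminf_finite) (use q z in \<open>auto simp: warnaar_term_def warnaar_coeff_def\<close>)
  then have "warnaar_sum q z (q / z) = qpoch_inf z q * qpoch_inf (q / z) q"
    by (simp add: warnaar_term_def warnaar_coeff_def)
  ultimately show ?thesis
    by (simp add: mult_ac)
qed

section \<open>Bailey pairs\<close>

text \<open>The alpha sequence of a Bailey pair relative to \<open>q = r^2\<close>, multiplied by
  \<open>1 - q\<close>. This normalization turns the usual denominator \<open>(q^2;q)\<close> at
  \<open>N + n\<close> into \<open>(q;q)\<close> at \<open>N + n + 1\<close>.\<close>

definition slater_alpha :: "complex \<Rightarrow> nat \<Rightarrow> complex" where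
  "slater_alpha r n = (-1) ^ n * r ^ (3 * (n choose 2) + n) * (1 - (r\<^sup>2) ^ (2 * n + 1))"

text \<open>
  WZ certificate for \<open>slater_bailey_pair\<close>, with \<open>u = q\<^sup>N\<close> and \<open>x = r\<^sup>n\<close>.
\<close>

lemma slater_wz_identity:
  fixes r u x :: complex
  defines "p \<equiv> \<lambda>x. u * r^2 * (x^5 - 1) + u^2 * r^3 * (x^4 - x) - u * r * (u * r^3 - 1) * (x^3 - x^2)"
  shows "r * ((1 - u * r^2) * (1 + u * r) * (1 + u * r^2) * (1 - r^2 * x^4) * x^2
      - (1 - r^2 * x^4) * (x^2 - u * r^2) * (1 - u * r^4 * x^2))
    = - (p (x * r) * x * (x^2 - u * r^2)) - r * (p x * (1 - u * r^4 * x^2))"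
  unfolding p_def by algebra

text \<open>Induction on \<open>N\<close> by the WZ method. \<open>K\<close> is the quotient of the
  denominators of the left-hand side at \<open>N + 1\<close> and \<open>N\<close>; \<open>K\<close>
  times the summand at \<open>N + 1\<close> minus the summand at \<open>N\<close> is a difference of
  the certificate \<open>G\<close>.\<close>

lemma slater_bailey_pair:
  fixes r :: complex
  assumes r: "norm r < 1" "r \<noteq> 0"
  defines "q \<equiv> r\<^sup>2"
  shows "1 / (qfac q q N * qfac (- r) r (2 * N))
    = (\<Sum>n\<le>N. slater_alpha r n / (qfac q q (N - n) * qfac q q (N + n + 1)))"
proof (induction N)
  case 0
  have "r\<^sup>2 \<noteq> 1"
    using r by (metis norm_one norm_power power_eq_1_iff norm_ge_zero less_irrefl zero_less_numeral pos2 less_imp_neq)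
  then show ?case
    by (simp add: slater_alpha_def q_def qfac_def binomial_eq_0)
next
  case (Suc N)
  define u where "u = q ^ N"
  define p where "p = (\<lambda>x. u * r^2 * (x^5 - 1) + u^2 * r^3 * (x^4 - x) - u * r * (u * r^3 - 1) * (x^3 - x^2))"
  define s where "s n = (-1) ^ n * r ^ (3 * (n choose 2) + n)" for n :: nat
  define K where "K = (1 - u * r^2) * (1 + u * r) * (1 + u * r^2)"
  define G where "G n = s n * p (r ^ n) / (r ^ (2 * n) * (qfac q q (Suc N - n) * qfac q q (N + n + 1)))" for n
  have "norm q < 1"
    using r by (simp add: q_def norm_power power_less_one_iff)
  note ne = qfac_q_nonzero[OF this]
  have s_Suc: "s (Suc n) = - s n * (r * (r ^ n) ^ 3)" for n
  proof -
    have e: "3 * (Suc n choose 2) + Suc n = (3 * (n choose 2) + n) + (n * 3 + 1)"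
      by (simp add: choose_two_Suc)
    show ?thesis
      unfolding s_def e power_add by (simp add: power_mult)
  qed
  have al: "slater_alpha r n = s n * (1 - r^2 * (r ^ n) ^ 4)" for n
    by (simp add: slater_alpha_def s_def mult_ac flip: power_mult)
  have step: "K * (slater_alpha r n / (qfac q q (Suc N - n) * qfac q q (Suc N + n + 1)))
      - slater_alpha r n / (qfac q q (N - n) * qfac q q (N + n + 1)) = G (Suc n) - G n" if "n \<le> N" for n
  proof -
    define x where "x = r ^ n"
    define D where "D = qfac q q (Suc N - n) * qfac q q (N + n + 2)"
    have x0: "x \<noteq> 0"
      using r by (simp add: x_def)
    have x2: "x ^ 2 = q ^ n"
      by (simp add: x_def q_def power_mult[symmetric] mult.commute)
    \<comment> \<open>Multiplication by \<open>x^2 = q ^ n\<close> turns the factor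
      \<open>1 - q ^ (N + 1 - n)\<close> into the polynomial \<open>x^2 - u r^2\<close>.\<close>
    have D1: "D * x\<^sup>2 = (qfac q q (N - n) * (x\<^sup>2 - u * r\<^sup>2)) * qfac q q (N + n + 2)"
    proof -
      have "u * r\<^sup>2 = q * q ^ (N - n) * x\<^sup>2"
        using that by (simp add: x2 u_def q_def mult.commute mult.left_commute flip: power_add)
      then have "x\<^sup>2 - u * r\<^sup>2 = (1 - q * q ^ (N - n)) * x\<^sup>2"
        by (simp add: algebra_simps)
      then show ?thesis
        using that by (simp add: D_def Suc_diff_le qfac_Suc)
    qed
    have D2: "qfac q q (N + n + 2) = qfac q q (N + n + 1) * (1 - u * r ^ 4 * x\<^sup>2)"
    proof -
      have "r ^ 4 = q * q"
        by (simp add: q_def flip: power_add)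
      then have "u * r ^ 4 * x\<^sup>2 = q * q ^ (N + n + 1)"
        unfolding x2 u_def by (simp add: power_add mult_ac)
      then show ?thesis
        by (simp add: qfac_Suc)
    qed
    have D0: "D \<noteq> 0" "x\<^sup>2 - u * r\<^sup>2 \<noteq> 0" "1 - u * r ^ 4 * x\<^sup>2 \<noteq> 0"
      using ne x0 D1 D2 by (auto simp: D_def)
    have al: "slater_alpha r n = s n * (1 - r^2 * x ^ 4)"
      unfolding x_def by (rule al)
    have 1: "slater_alpha r n / (qfac q q (Suc N - n) * qfac q q (Suc N + n + 1))
       = s n / (r * (D * x\<^sup>2)) * (r * ((1 - r^2 * x ^ 4) * x\<^sup>2))"
      using x0 r(2) by (simp add: al D_def)
    have 2: "slater_alpha r n / (qfac q q (N - n) * qfac q q (N + n + 1))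
       = s n / (r * (D * x\<^sup>2)) * (r * ((1 - r^2 * x^4) * (x^2 - u * r^2) * (1 - u * r^4 * x^2)))"
      unfolding al D1 D2 using D0(2,3) r(2) by simp
    have 3: "G (Suc n) = s n / (r * (D * x\<^sup>2)) * (- (p (x * r) * x * (x^2 - u * r^2)))"
    proof -
      have "G (Suc n) = - s n * (r * x ^ 3) * p (x * r) / (r\<^sup>2 * x\<^sup>2 * (qfac q q (N - n) * qfac q q (N + n + 2)))"
        by (simp add: G_def s_Suc x_def power_mult power2_eq_square power_mult_distrib mult_ac flip: power_add)
      also have "\<dots> = s n / (r * (D * x\<^sup>2)) * (- (p (x * r) * x * (x^2 - u * r^2)))"
        unfolding D1 using D0(2) r(2) x0 by (simp add: power2_eq_square power3_eq_cube)
      finally show ?thesis .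
    qed
    have 4: "G n = s n / (r * (D * x\<^sup>2)) * (r * (p x * (1 - u * r^4 * x^2)))"
    proof -
      have "r ^ (2 * n) = x\<^sup>2"
        by (simp add: x_def mult.commute flip: power_mult)
      then show ?thesis
        unfolding G_def D_def D2 x_def[symmetric] using D0(3) r(2) by simp
    qed
    have "K * (s n / (r * (D * x\<^sup>2)) * (r * ((1 - r^2 * x ^ 4) * x\<^sup>2)))
       - s n / (r * (D * x\<^sup>2)) * (r * ((1 - r^2 * x^4) * (x^2 - u * r^2) * (1 - u * r^4 * x^2)))
       = s n / (r * (D * x\<^sup>2)) * (r * (K * (1 - r^2 * x^4) * x^2
      - (1 - r^2 * x^4) * (x^2 - u * r^2) * (1 - u * r^4 * x^2)))"
    proof -
      have "K * (c * (r * (y * z))) - c * (r * w) = c * (r * (K * y * z - w))" for c y z w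
        by (simp add: algebra_simps)
      then show ?thesis .
    qed
    also have "\<dots> = s n / (r * (D * x\<^sup>2)) * (- (p (x * r) * x * (x^2 - u * r^2)) - r * (p x * (1 - u * r^4 * x^2)))"
      unfolding K_def p_def slater_wz_identity ..
    finally show ?thesis
      unfolding 1 2 3 4 by (simp only: right_diff_distrib)
  qed
  \<comment> \<open>The summand \<open>n = N + 1\<close> has no counterpart at \<open>N\<close>; it
    cancels the upper boundary value of the telescoping sum. On this edge
    \<open>x^2 = u r^2\<close>, which makes \<open>K x^2 = - p x\<close>.\<close>
  have edge: "K * (slater_alpha r (Suc N) / (qfac q q 0 * qfac q q (Suc N + Suc N + 1))) = - G (Suc N)"
  proof -
    define x where "x = r ^ Suc N"
    have x0: "x \<noteq> 0"
      using r by (simp add: x_def)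
    have u: "u * r\<^sup>2 = x\<^sup>2"
      by (simp add: u_def x_def q_def power2_eq_square power_mult_distrib mult_ac)
    have al: "slater_alpha r (Suc N) = s (Suc N) * (1 - r^2 * x ^ 4)"
      unfolding x_def by (rule al)
    have "x ^ 4 = (x\<^sup>2)\<^sup>2"
      by simp
    also have "\<dots> = q ^ (2 * N + 2)"
      unfolding u[symmetric] by (simp add: u_def q_def power_mult_distrib power_add mult.commute flip: power_mult)
    finally have c: "q * q ^ (2 * N + 2) = r^2 * x ^ 4"
      by (simp add: q_def)
    then have 1: "qfac q q (Suc N + Suc N + 1) = qfac q q (2 * N + 2) * (1 - r^2 * x ^ 4)"
      by (simp add: qfac_Suc mult_2)
    have "qfac q q (2 * N + 2) * (1 - r^2 * x ^ 4) \<noteq> 0"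
      using ne 1 by metis
    then have ne': "1 - r\<^sup>2 * x ^ 4 \<noteq> 0"
      by simp
    have K: "K = - p x / x\<^sup>2"
    proof -
      have "K * x\<^sup>2 = - p x"
        unfolding K_def p_def using u by algebra
      then show ?thesis
        using x0 by (simp add: field_simps)
    qed
    have "r ^ (2 * Suc N) = x\<^sup>2"
      unfolding x_def power_mult[symmetric] by (simp only: mult.commute)
    then show ?thesis
      unfolding al 1 G_def x_def[symmetric] K using ne' by (simp add: mult_2)
  qed
  let ?X = "\<lambda>n. slater_alpha r n / (qfac q q (Suc N - n) * qfac q q (Suc N + n + 1))"
  let ?Y = "\<lambda>n. slater_alpha r n / (qfac q q (N - n) * qfac q q (N + n + 1))"
  have "K * (\<Sum>n\<le>N. ?X n) - (\<Sum>n\<le>N. ?Y n) = (\<Sum>n\<le>N. G (Suc n) - G n)"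
    unfolding sum_distrib_left sum_subtractf[symmetric] by (intro sum.cong refl step) simp
  \<comment> \<open>The lower boundary value \<open>G 0\<close> is 0 because
    \<open>p 1 = 0\<close>.\<close>
  also have "\<dots> = G (Suc N)"
    unfolding lessThan_Suc_atMost[symmetric] sum_lessThan_telescope by (simp add: G_def p_def)
  finally have "K * (\<Sum>n\<le>Suc N. ?X n) = (\<Sum>n\<le>N. ?Y n)"
    using edge by (simp add: distrib_left algebra_simps)
  also have "\<dots> = 1 / (qfac q q N * qfac (- r) r (2 * N))"
    using Suc by simp
  finally have main: "K * (\<Sum>n\<le>Suc N. ?X n) = 1 / (qfac q q N * qfac (- r) r (2 * N))" .
  have fac: "qfac q q (Suc N) = qfac q q N * (1 - u * r\<^sup>2)"
    "qfac (- r) r (2 * Suc N) = qfac (- r) r (2 * N) * ((1 + u * r) * (1 + u * r\<^sup>2))"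
  proof -
    have "u = r ^ (2 * N)"
      by (simp add: u_def q_def power_mult)
    then show "qfac (- r) r (2 * Suc N) = qfac (- r) r (2 * N) * ((1 + u * r) * (1 + u * r\<^sup>2))"
      by (simp add: qfac_Suc power2_eq_square mult_ac)
  qed (simp add: qfac_Suc u_def q_def mult_ac)
  have "qfac (- r) r (2 * Suc N) \<noteq> 0"
  proof -
    have "norm (- r * r ^ j) < 1" for j
      using norm_mult_power_le[OF r(1), of "- r" j] r by simp
    then show ?thesis
      by (metis qfac_eq_0_iff norm_one less_irrefl)
  qed
  with ne[of "Suc N"] have "K \<noteq> 0" "qfac q q N \<noteq> 0" "qfac (- r) r (2 * N) \<noteq> 0"
    unfolding fac K_def by auto
  moreover have "qfac q q (Suc N) * qfac (- r) r (2 * Suc N) = K * (qfac q q N * qfac (- r) r (2 * N))"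
    unfolding fac K_def by (simp only: mult_ac)
  ultimately show ?case
    using main by (simp add: field_simps del: sum.atMost_Suc)
qed

text \<open>
  This is the limit \<open>\<rho>\<^sub>1, \<rho>\<^sub>2 \<rightarrow> \<infinity>\<close> of the summation behind Bailey's lemma.
\<close>

lemma q_chu_vandermonde:
  fixes q :: complex
  assumes q: "norm q < 1"
  shows "(\<Sum>j\<le>L. q ^ (j\<^sup>2 + c * j) / (qfac q q (L - j) * qfac q q j * qfac q q (j + c)))
    = 1 / (qfac q q L * qfac q q (L + c))"
\<comment> \<open>\<open>c\<close> is generalized because splitting \<open>1 - q ^ Suc L\<close>
  leads to the sums for \<open>L\<close> with both \<open>c\<close> and
  \<open>c + 1\<close>.\<close>
proof (induction L arbitrary: c)
  case 0
  then show ?case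
    by simp
next
  case (Suc L)
  note ne = qfac_q_nonzero[OF q]
  have ne': "1 - q ^ Suc j \<noteq> 0" for j
    using ne[of "Suc j"] by (auto simp: qfac_Suc)
  let ?f = "\<lambda>L c j. q ^ (j\<^sup>2 + c * j) / (qfac q q (L - j) * qfac q q j * qfac q q (j + c))"
  text \<open>Split \<open>1 - q\<^bsup>L+1\<^esup> = (1 - q\<^bsup>L+1-j\<^esup>) + q\<^bsup>L+1-j\<^esup> (1 - q\<^bsup>j\<^esup>)\<close> in each summand.\<close>
  have "(1 - q ^ Suc L) * (\<Sum>j\<le>Suc L. ?f (Suc L) c j)
      = (\<Sum>j\<le>Suc L. (1 - q ^ (Suc L - j)) * ?f (Suc L) c j)
        + (\<Sum>j\<le>Suc L. q ^ (Suc L - j) * (1 - q ^ j) * ?f (Suc L) c j)"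
    unfolding sum_distrib_left sum.distrib[symmetric]
  proof (intro sum.cong refl)
    fix j assume "j \<in> {..Suc L}"
    then have "q ^ Suc L = q ^ (Suc L - j) * q ^ j"
      by (simp flip: power_add)
    then have "1 - q ^ Suc L = (1 - q ^ (Suc L - j)) + q ^ (Suc L - j) * (1 - q ^ j)"
      by (simp add: right_diff_distrib)
    then show "(1 - q ^ Suc L) * ?f (Suc L) c j
        = (1 - q ^ (Suc L - j)) * ?f (Suc L) c j + q ^ (Suc L - j) * (1 - q ^ j) * ?f (Suc L) c j"
      by (metis distrib_right)
  qed
  also have "(\<Sum>j\<le>Suc L. (1 - q ^ (Suc L - j)) * ?f (Suc L) c j) = (\<Sum>j\<le>L. ?f L c j)"
  proof -
    have "(1 - q ^ (Suc L - j)) * ?f (Suc L) c j = ?f L c j" if "j \<le> L" for j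
    proof -
      have "qfac q q (Suc L - j) = qfac q q (L - j) * (1 - q ^ (Suc L - j))"
        using that by (simp add: Suc_diff_le qfac_Suc)
      moreover have "1 - q ^ (Suc L - j) \<noteq> 0"
        using that ne'[of "L - j"] by (simp add: Suc_diff_le)
      ultimately show ?thesis
        by simp
    qed
    then show ?thesis
      by simp
  qed
  also have "\<dots> = 1 / (qfac q q L * qfac q q (L + c))"
    by (rule Suc)
  also have "(\<Sum>j\<le>Suc L. q ^ (Suc L - j) * (1 - q ^ j) * ?f (Suc L) c j)
      = q ^ (L + c + 1) * (\<Sum>j\<le>L. ?f L (Suc c) j)"
  proof -
    have "q ^ (Suc L - Suc j) * (1 - q ^ Suc j) * ?f (Suc L) c (Suc j) = q ^ (L + c + 1) * ?f L (Suc c) j"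
      if "j \<le> L" for j
    proof -
      have "(Suc L - Suc j) + ((Suc j)\<^sup>2 + c * Suc j) = (L + c + 1) + (j\<^sup>2 + Suc c * j)"
        using that by (simp add: power2_eq_square algebra_simps)
      then have e: "q ^ (Suc L - Suc j) * q ^ ((Suc j)\<^sup>2 + c * Suc j) = q ^ (L + c + 1) * q ^ (j\<^sup>2 + Suc c * j)"
        by (simp only: flip: power_add)
      have "q ^ (Suc L - Suc j) * (1 - q ^ Suc j) * ?f (Suc L) c (Suc j)
          = (q ^ (Suc L - Suc j) * q ^ ((Suc j)\<^sup>2 + c * Suc j))
            / (qfac q q (L - j) * qfac q q j * qfac q q (j + Suc c))"
        using ne'[of j] by (simp add: qfac_Suc)
      then show ?thesis
        unfolding e by (simp only: times_divide_eq_right)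
    qed
    then show ?thesis
      unfolding sum.atMost_Suc_shift sum_distrib_left by (simp del: diff_Suc_Suc power_Suc)
  qed
  also have "(\<Sum>j\<le>L. ?f L (Suc c) j) = 1 / (qfac q q L * qfac q q (L + Suc c))"
    by (rule Suc)
  also have "1 / (qfac q q L * qfac q q (L + c)) + q ^ (L + c + 1) * (1 / (qfac q q L * qfac q q (L + Suc c)))
      = 1 / (qfac q q L * qfac q q (Suc L + c))"
    using ne'[of "L + c"] ne[of "L + c"] ne[of L] by (simp add: qfac_Suc field_simps)
  finally have main: "(1 - q ^ Suc L) * (\<Sum>j\<le>Suc L. ?f (Suc L) c j) = 1 / (qfac q q L * qfac q q (Suc L + c))" .
  have "y = z / x" if "x * y = z" "x \<noteq> 0" for x y z :: complex
    using that by auto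
  from this[OF main ne'[of L]]
  have "(\<Sum>j\<le>Suc L. ?f (Suc L) c j) = 1 / (qfac q q L * qfac q q (Suc L + c)) / (1 - q ^ Suc L)" .
  also have "\<dots> = 1 / (qfac q q (Suc L) * qfac q q (Suc L + c))"
    by (simp add: qfac_Suc[of _ _ L])
  finally show ?case .
qed

text \<open>After inserting \<beta> and exchanging the sums, the inner sum over
  \<open>m = n + j\<close> is \<open>q_chu_vandermonde\<close> with \<open>c = 2 * n + 1\<close>.
  The new pair has \<alpha> multiplied by \<open>q ^ (n^2 + n)\<close>.\<close>

lemma bailey_step:
  fixes q :: complex and \<alpha> \<beta> :: "nat \<Rightarrow> complex"
  assumes q: "norm q < 1"
    and \<beta>: "\<And>m. \<beta> m = (\<Sum>n\<le>m. \<alpha> n / (qfac q q (m - n) * qfac q q (m + n + 1)))"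
  shows "(\<Sum>m\<le>L. q ^ (m\<^sup>2 + m) / qfac q q (L - m) * \<beta> m)
    = (\<Sum>n\<le>L. q ^ (n\<^sup>2 + n) * \<alpha> n / (qfac q q (L - n) * qfac q q (L + n + 1)))"
proof -
  let ?t = "\<lambda>m n. q ^ (m\<^sup>2 + m) * \<alpha> n / (qfac q q (L - m) * qfac q q (m - n) * qfac q q (m + n + 1))"
  have "(\<Sum>m\<le>L. q ^ (m\<^sup>2 + m) / qfac q q (L - m) * \<beta> m) = (\<Sum>m\<le>L. \<Sum>n\<le>m. ?t m n)"
    unfolding \<beta> sum_distrib_left by (simp add: mult_ac)
  also have "\<dots> = (\<Sum>n\<le>L. \<Sum>m\<in>{n..L}. ?t m n)"
    unfolding sum.Sigma[OF finite_atMost ballI, OF finite_atMost] sum.Sigma[OF finite_atMost ballI, OF finite_atLeastAtMost]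
    by (rule sum.reindex_bij_witness[of _ "\<lambda>(n, m). (m, n)" "\<lambda>(m, n). (n, m)"]) auto
  also have "\<dots> = (\<Sum>n\<le>L. q ^ (n\<^sup>2 + n) * \<alpha> n / (qfac q q (L - n) * qfac q q (L + n + 1)))"
  proof (intro sum.cong refl)
    fix n assume "n \<in> {..L}"
    then have n: "n \<le> L"
      by simp
    have "(\<Sum>m\<in>{n..L}. ?t m n) = (\<Sum>j\<le>L - n. ?t (j + n) n)"
      by (rule sum.reindex_bij_witness[of _ "\<lambda>j. j + n" "\<lambda>m. m - n"]) (use n in auto)
    also have "\<dots> = q ^ (n\<^sup>2 + n) * \<alpha> n * (\<Sum>j\<le>L - n. q ^ (j\<^sup>2 + (2 * n + 1) * j)
        / (qfac q q (L - n - j) * qfac q q j * qfac q q (j + (2 * n + 1))))"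
      unfolding sum_distrib_left
    proof (intro sum.cong refl)
      fix j
      have e: "(j + n)\<^sup>2 + (j + n) = (n\<^sup>2 + n) + (j\<^sup>2 + (2 * n + 1) * j)" "j + n + n + 1 = j + (2 * n + 1)"
        "L - (j + n) = L - n - j" "j + n - n = j"
        by (simp_all add: power2_eq_square algebra_simps)
      show "?t (j + n) n = q ^ (n\<^sup>2 + n) * \<alpha> n * (q ^ (j\<^sup>2 + (2 * n + 1) * j)
        / (qfac q q (L - n - j) * qfac q q j * qfac q q (j + (2 * n + 1))))"
        unfolding e power_add[of q "n\<^sup>2 + n"] by simp
    qed
    also have "\<dots> = q ^ (n\<^sup>2 + n) * \<alpha> n * (1 / (qfac q q (L - n) * qfac q q (L - n + (2 * n + 1))))"
      by (simp only: q_chu_vandermonde[OF q])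
    also have "L - n + (2 * n + 1) = L + n + 1"
      using n by simp
    finally show "(\<Sum>m\<in>{n..L}. ?t m n) = q ^ (n\<^sup>2 + n) * \<alpha> n / (qfac q q (L - n) * qfac q q (L + n + 1))"
      by simp
  qed
  finally show ?thesis .
qed

fun bailey_beta :: "complex \<Rightarrow> nat \<Rightarrow> nat \<Rightarrow> complex" where
  "bailey_beta r 0 n = 1 / (qfac (r\<^sup>2) (r\<^sup>2) n * qfac (- r) r (2 * n))"
| "bailey_beta r (Suc i) n = (\<Sum>m\<le>n. (r\<^sup>2) ^ (m\<^sup>2 + m) / qfac (r\<^sup>2) (r\<^sup>2) (n - m) * bailey_beta r i m)"

lemma bailey_beta_eq:
  fixes r :: complex
  assumes r: "norm r < 1" "r \<noteq> 0"
  defines "q \<equiv> r\<^sup>2"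
  shows "bailey_beta r i m
    = (\<Sum>n\<le>m. (q ^ (n\<^sup>2 + n)) ^ i * slater_alpha r n / (qfac q q (m - n) * qfac q q (m + n + 1)))"
proof (induction i arbitrary: m)
  case 0
  then show ?case
    using slater_bailey_pair[OF r, of m] by (simp add: q_def)
next
  case (Suc i)
  have q: "norm q < 1"
    using r by (simp add: q_def norm_power power_less_one_iff)
  show ?case
    using bailey_step[OF q Suc, of m] by (simp add: q_def mult.assoc)
qed

section \<open>The inner sum as the end of a Bailey chain\<close>

text \<open>The denominator of \<open>qpoch\<close> consists of the factors from index
  \<open>n\<close> on, hence the form of the second hypothesis.\<close>

lemma qpoch_eq_qfac:
  fixes x q :: complex
  assumes "norm q < 1" and "\<And>j. x * q ^ (n + j) \<noteq> 1"
  shows "qpoch x q (int n) = qfac x q n"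
proof -
  have "qpoch_inf (x * q ^ n) q \<noteq> 0"
    using assms by (simp add: qpoch_inf_eq_0_iff power_add mult.assoc)
  then show ?thesis
    unfolding qfac_def by (rule qpoch_nat[OF assms(1)])
qed

lemma norm_less_1_power_neq_1:
  fixes x q :: complex
  assumes "norm q < 1" "norm x < 1"
  shows "x * q ^ j \<noteq> 1"
  using norm_mult_power_le[OF assms(1), of x j] assms(2) by (metis norm_one not_le)

lemma qpoch_q_eq_qfac:
  fixes q :: complex
  assumes "norm q < 1"
  shows "qpoch q q (int n) = qfac q q n"
  by (intro qpoch_eq_qfac norm_less_1_power_neq_1 assms)

lemma inv_qq_eq:
  fixes q :: complex
  assumes "norm q < 1"
  shows "inv_qq q (int n - int m) = (if m \<le> n then 1 / qfac q q (n - m) else 0)"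
proof (cases "m \<le> n")
  case True
  then have "int n - int m = int (n - m)"
    by simp
  then show ?thesis
    using True by (simp add: inv_qq_def qpoch_q_eq_qfac[OF assms] del: of_nat_diff)
qed (simp add: inv_qq_def)

lemma qpoch_minus_r_eq_qfac:
  fixes r :: complex
  assumes "norm r < 1"
  shows "qpoch (- r) r (2 * int n) = qfac (- r) r (2 * n)"
  using qpoch_eq_qfac[of r "- r" "2 * n"] norm_less_1_power_neq_1[OF assms, of "- r"] assms by simp

section \<open>Summation over tuples, one coordinate at a time\<close>

lemma sum_PiE_insert:
  assumes "j \<notin> I"
  shows "sum F (insert j I \<rightarrow>\<^sub>E A) = (\<Sum>g\<in>I \<rightarrow>\<^sub>E A. \<Sum>y\<in>A. F (g(j := y)))"
proof -
  have "sum F (insert j I \<rightarrow>\<^sub>E A) = (\<Sum>(y, g)\<in>A \<times> (I \<rightarrow>\<^sub>E A). F (g(j := y)))"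
    unfolding PiE_insert_eq
    using sum.reindex[OF inj_combinator[OF assms, of "\<lambda>_. A"], of F] by (simp add: o_def case_prod_unfold)
  also have "\<dots> = (\<Sum>y\<in>A. \<Sum>g\<in>I \<rightarrow>\<^sub>E A. F (g(j := y)))"
    by (simp add: sum.cartesian_product)
  finally show ?thesis
    by (simp add: sum.swap[of _ A])
qed

text \<open>
  The summand with \<open>n\<^sub>1, \<dots>, n\<^bsub>j-1\<^esub>\<close> removed: only the tail \<open>n\<^sub>j, \<dots>, n\<^bsub>k-1\<^esub>\<close> of the tuple
  is used, which makes an induction on \<open>j\<close> downwards from \<open>k - 1\<close> possible.
\<close>

definition tuple_term :: "complex \<Rightarrow> complex \<Rightarrow> nat \<Rightarrow> nat \<Rightarrow> nat \<Rightarrow> (nat \<Rightarrow> nat) \<Rightarrow> complex" where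
  "tuple_term q r k j n ns =
     q ^ (\<Sum>l=j..k-1. (tail_sum k ns l)\<^sup>2 + tail_sum k ns l)
     * inv_qq q (int n - int (tail_sum k ns j))
     / ((\<Prod>l=j..k-1. qpoch q q (int (ns l))) * qpoch (- r) r (2 * int (ns (k - 1))))"

lemma inner_term_eq_tuple_term: "inner_term q r k n ns = tuple_term q r k 1 n ns"
  by (simp add: inner_term_def tuple_term_def sum.distrib)

text \<open>Isolates the dependence on the coordinate \<open>y\<close>. As \<open>j < k - 1\<close>,
  neither the later tails nor the last coordinate \<open>g (k - 1)\<close> change when
  \<open>g\<close> is updated at \<open>j\<close>.\<close>

lemma tuple_term_Suc:
  assumes "j < k - 1"
  shows "tuple_term q r k j n (g(j := y))
    = q ^ ((y + tail_sum k g (Suc j))\<^sup>2 + (y + tail_sum k g (Suc j)))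
      * inv_qq q (int n - int (y + tail_sum k g (Suc j))) / qpoch q q (int y)
      * (q ^ (\<Sum>l=Suc j..k-1. (tail_sum k g l)\<^sup>2 + tail_sum k g l)
         / ((\<Prod>l=Suc j..k-1. qpoch q q (int (g l))) * qpoch (- r) r (2 * int (g (k - 1)))))"
proof -
  have j: "j \<le> k - 1"
    using assms by simp
  have 1: "tail_sum k (g(j := y)) l = tail_sum k g l" if "l \<ge> Suc j" for l
    unfolding tail_sum_def by (intro sum.cong) (use that in auto)
  have 2: "tail_sum k (g(j := y)) j = y + tail_sum k g (Suc j)"
    using 1[of "Suc j"] sum.atLeast_Suc_atMost[OF j, of "g(j := y)"] by (simp add: tail_sum_def)
  have 3: "(\<Sum>l=Suc j..k-1. (tail_sum k (g(j := y)) l)\<^sup>2 + tail_sum k (g(j := y)) l)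
      = (\<Sum>l=Suc j..k-1. (tail_sum k g l)\<^sup>2 + tail_sum k g l)"
    by (intro sum.cong refl) (simp add: 1)
  have 4: "(\<Prod>l=Suc j..k-1. qpoch q q (int ((g(j := y)) l))) = (\<Prod>l=Suc j..k-1. qpoch q q (int (g l)))"
    by (intro prod.cong refl) auto
  show ?thesis
    unfolding tuple_term_def sum.atLeast_Suc_atMost[OF j] prod.atLeast_Suc_atMost[OF j] 2 3 4
    using assms by (simp add: power_add mult_ac)
qed

text \<open>Substitution \<open>m = y + N\<close>. The convention for \<open>inv_qq\<close> removes
  \<open>y + N > n\<close> on the left and \<open>m < N\<close> on the right, so the value is the
  same for every cutoff \<open>M\<close> with \<open>n <= M\<close>.\<close>

lemma sum_shift_inv_qq:
  fixes q :: complex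
  assumes q: "norm q < 1" and n: "n \<le> M"
  shows "(\<Sum>y\<le>M. q ^ ((y + N)\<^sup>2 + (y + N)) * inv_qq q (int n - int (y + N)) / qpoch q q (int y))
    = (\<Sum>m\<le>n. q ^ (m\<^sup>2 + m) / qfac q q (n - m) * inv_qq q (int m - int N))"
proof -
  let ?g = "\<lambda>y. q ^ ((y + N)\<^sup>2 + (y + N)) * (if y + N \<le> n then 1 / qfac q q (n - (y + N)) else 0) / qfac q q y"
  let ?h = "\<lambda>m. q ^ (m\<^sup>2 + m) / qfac q q (n - m) * (if N \<le> m then 1 / qfac q q (m - N) else 0)"
  have "(\<Sum>y\<le>M. ?g y) = (\<Sum>y\<in>{y. y \<le> M \<and> y + N \<le> n}. ?g y)"
    by (rule sum.mono_neutral_right) auto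
  also have "\<dots> = (\<Sum>m\<in>{m. m \<le> n \<and> N \<le> m}. ?h m)"
    by (rule sum.reindex_bij_witness[of _ "\<lambda>m. m - N" "\<lambda>y. y + N"]) (use n in auto)
  also have "\<dots> = (\<Sum>m\<le>n. ?h m)"
    by (rule sum.mono_neutral_left) auto
  finally show ?thesis
    unfolding inv_qq_eq[OF q] qpoch_q_eq_qfac[OF q] .
qed

text \<open>Downward induction on \<open>j\<close>, each coordinate contributing one step of the
  chain. The cutoff \<open>M\<close> is separate from \<open>n\<close> so that the set of tuples
  stays fixed while the induction hypothesis is used for all \<open>m <= n\<close>.\<close>

lemma sum_tuple_term:
  fixes r :: complex
  assumes r: "norm r < 1" and "j \<le> k - 1" and "n \<le> M"
  shows "sum (tuple_term (r\<^sup>2) r k j n) ({j..k-1} \<rightarrow>\<^sub>E {..M}) = bailey_beta r (Suc (k - 1 - j)) n"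
  using assms(2,3)
proof (induction j arbitrary: n rule: inc_induct)
  case base
  have q: "norm (r\<^sup>2) < 1"
    using r by (simp add: norm_power power_less_one_iff)
  have "sum (tuple_term (r\<^sup>2) r k (k - 1) n) ({k-1..k-1} \<rightarrow>\<^sub>E {..M})
      = (\<Sum>y\<le>M. (r\<^sup>2) ^ (y\<^sup>2 + y) * inv_qq (r\<^sup>2) (int n - int y) / (qfac (r\<^sup>2) (r\<^sup>2) y * qfac (- r) r (2 * y)))"
    using sum_PiE_insert[of "k - 1" "{}" "tuple_term (r\<^sup>2) r k (k - 1) n" "{..M}"]
    by (simp add: tuple_term_def tail_sum_def qpoch_q_eq_qfac[OF q] qpoch_minus_r_eq_qfac[OF r])
  also have "\<dots> = (\<Sum>y\<le>n. (r\<^sup>2) ^ (y\<^sup>2 + y) * inv_qq (r\<^sup>2) (int n - int y) / (qfac (r\<^sup>2) (r\<^sup>2) y * qfac (- r) r (2 * y)))"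
    by (rule sum.mono_neutral_right) (use base in \<open>auto simp: inv_qq_eq[OF q]\<close>)
  also have "\<dots> = bailey_beta r (Suc 0) n"
    by (auto simp: inv_qq_eq[OF q] intro!: sum.cong)
  finally show ?case
    by simp
next
  case (step j)
  have q: "norm (r\<^sup>2) < 1"
    using r by (simp add: norm_power power_less_one_iff)
  let ?R = "\<lambda>g. (r\<^sup>2) ^ (\<Sum>l=Suc j..k-1. (tail_sum k g l)\<^sup>2 + tail_sum k g l)
         / ((\<Prod>l=Suc j..k-1. qpoch (r\<^sup>2) (r\<^sup>2) (int (g l))) * qpoch (- r) r (2 * int (g (k - 1))))"
  have ins: "{j..k-1} = insert j {Suc j..k-1}"
    using step by auto
  have "sum (tuple_term (r\<^sup>2) r k j n) ({j..k-1} \<rightarrow>\<^sub>E {..M})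
      = (\<Sum>g\<in>{Suc j..k-1} \<rightarrow>\<^sub>E {..M}. \<Sum>y\<le>M. tuple_term (r\<^sup>2) r k j n (g(j := y)))"
    unfolding ins by (rule sum_PiE_insert) simp
  also have "\<dots> = (\<Sum>g\<in>{Suc j..k-1} \<rightarrow>\<^sub>E {..M}. \<Sum>m\<le>n. (r\<^sup>2) ^ (m\<^sup>2 + m) / qfac (r\<^sup>2) (r\<^sup>2) (n - m)
        * tuple_term (r\<^sup>2) r k (Suc j) m g)"
    unfolding tuple_term_Suc[OF step(2)] sum_distrib_right[symmetric] sum_shift_inv_qq[OF q step.prems]
    unfolding sum_distrib_right tuple_term_def
    by (simp only: times_divide_eq_left times_divide_eq_right mult.assoc mult.left_commute mult.commute)
  also have "\<dots> = (\<Sum>m\<le>n. (r\<^sup>2) ^ (m\<^sup>2 + m) / qfac (r\<^sup>2) (r\<^sup>2) (n - m)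
        * sum (tuple_term (r\<^sup>2) r k (Suc j) m) ({Suc j..k-1} \<rightarrow>\<^sub>E {..M}))"
    unfolding sum_distrib_left by (rule sum.swap)
  also have "\<dots> = (\<Sum>m\<le>n. (r\<^sup>2) ^ (m\<^sup>2 + m) / qfac (r\<^sup>2) (r\<^sup>2) (n - m) * bailey_beta r (Suc (k - 1 - Suc j)) m)"
    using step by (intro sum.cong refl) simp
  also have "Suc (k - 1 - Suc j) = k - 1 - j"
    using step(2) by simp
  finally show ?case
    by simp
qed

lemma inner_sum_eq_bailey_beta:
  fixes r :: complex
  assumes r: "norm r < 1" and "k \<ge> 1"
  shows "inner_sum (r\<^sup>2) r k n = bailey_beta r (k - 1) n"
proof (cases "k = 1")
  case True
  have "norm (r\<^sup>2) < 1"
    using r by (simp add: norm_power power_less_one_iff)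
  then show ?thesis
    using True r by (simp add: inner_sum_def qpoch_q_eq_qfac qpoch_minus_r_eq_qfac)
next
  case False
  with assms have k: "1 \<le> k - 1"
    by simp
  \<comment> \<open>\<open>inv_qq\<close> forces the full tail sum, and with it every coordinate, to
    be at most \<open>n\<close>; the infinite sum is therefore a finite one.\<close>
  have "inner_term (r\<^sup>2) r k n ns = 0" if "ns \<in> ({1..k-1} \<rightarrow>\<^sub>E UNIV) - ({1..k-1} \<rightarrow>\<^sub>E {..n})" for ns
  proof -
    from that obtain j where j: "j \<in> {1..k-1}" "ns j > n"
      by (auto simp: PiE_iff not_le)
    then have "ns j \<le> tail_sum k ns 1"
      unfolding tail_sum_def by (intro member_le_sum) auto
    then show ?thesis
      using j by (simp add: inner_term_def inv_qq_def)
  qed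
  then have "(\<Sum>\<^sub>\<infinity>ns \<in> {1..k-1} \<rightarrow>\<^sub>E UNIV. inner_term (r\<^sup>2) r k n ns)
      = (\<Sum>\<^sub>\<infinity>ns \<in> {1..k-1} \<rightarrow>\<^sub>E {..n}. inner_term (r\<^sup>2) r k n ns)"
    using PiE_mono[of "{1..k-1}" "\<lambda>_. {..n}" "\<lambda>_. UNIV"]
    by (intro infsum_cong_neutral) auto
  also have "\<dots> = sum (tuple_term (r\<^sup>2) r k 1 n) ({1..k-1} \<rightarrow>\<^sub>E {..n})"
    by (subst infsum_finite) (auto intro: finite_PiE simp: inner_term_eq_tuple_term)
  also have "\<dots> = bailey_beta r (Suc (k - 1 - 1)) n"
    by (rule sum_tuple_term[OF r k]) simp
  also have "Suc (k - 1 - 1) = k - 1"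
    using k by simp
  finally show ?thesis
    using False by (simp add: inner_sum_def)
qed

section \<open>Exchanging summations\<close>

lemma summable_on_real_product:
  fixes g :: "'a \<Rightarrow> real" and h :: "'b \<Rightarrow> real"
  assumes nonneg: "\<And>x. 0 \<le> g x" "\<And>y. 0 \<le> h y"
    and summable: "g summable_on A" "h summable_on B"
  shows "(\<lambda>(x, y). g x * h y) summable_on A \<times> B"
proof (rule summable_on_SigmaI)
  show "((\<lambda>y. case (x, y) of (x, y) \<Rightarrow> g x * h y) has_sum g x * infsum h B) B" for x
    using has_sum_cmult_right[OF has_sum_infsum[OF summable(2)]] by simp
  show "(\<lambda>x. g x * infsum h B) summable_on A"
    by (intro summable_on_cmult_left summable)
qed (use nonneg in auto)

lemma summable_on_product_bound:
  fixes f :: "'a \<times> 'b \<Rightarrow> complex" and g :: "'a \<Rightarrow> real" and h :: "'b \<Rightarrow> real"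
  assumes bound: "\<And>x y. norm (f (x, y)) \<le> g x * h y"
    and nonneg: "\<And>x. 0 \<le> g x" "\<And>y. 0 \<le> h y"
    and summable: "g summable_on A" "h summable_on B"
  shows "f summable_on A \<times> B"
proof (rule abs_summable_summable)
  show "(\<lambda>z. norm (f z)) summable_on A \<times> B"
    by (rule summable_on_comparison_test[OF summable_on_real_product[OF nonneg summable]])
       (use bound in auto)
qed

text \<open>The unordered sum over pairs mediates between the orders of summation: the next two
  lemmas compare rows with columns and rows with antidiagonals through it.\<close>

lemma row_sums_has_sum:
  fixes f :: "nat \<times> nat \<Rightarrow> complex"
  assumes f: "f summable_on UNIV \<times> UNIV" and a: "\<And>n. (\<lambda>s. f (n, s)) sums a n"
  shows "(a has_sum infsum f (UNIV \<times> UNIV)) UNIV"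
proof (rule has_sum_SigmaD[OF has_sum_infsum[OF f]])
  fix n :: nat
  have "(\<lambda>(x, y). f (x, y)) summable_on UNIV \<times> UNIV"
    using f by simp
  from has_sum_infsum[OF summable_on_SigmaD1[OF this, of n]]
  have *: "((\<lambda>s. f (n, s)) has_sum infsum (\<lambda>s. f (n, s)) UNIV) UNIV"
    by simp
  with a[of n] show "((\<lambda>s. f (n, s)) has_sum a n) UNIV"
    using sums_unique2[OF has_sum_imp_sums[OF *]] by simp
qed

lemma sums_swap:
  fixes f :: "nat \<times> nat \<Rightarrow> complex"
  assumes f: "f summable_on UNIV \<times> UNIV"
    and a: "\<And>n. (\<lambda>m. f (n, m)) sums a n" and b: "\<And>m. (\<lambda>n. f (n, m)) sums b m"
  obtains S where "a sums S" "b sums S"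
proof -
  let ?g = "\<lambda>(x, y). f (y, x)"
  have "?g summable_on UNIV \<times> UNIV"
    using f summable_on_swap[of f UNIV UNIV] by simp
  from row_sums_has_sum[OF this, of b] b have "(b has_sum infsum ?g (UNIV \<times> UNIV)) UNIV"
    by simp
  moreover have "infsum ?g (UNIV \<times> UNIV) = infsum f (UNIV \<times> UNIV)"
    using has_sum_infsum[OF f] has_sum_swap[where f = f and A = UNIV and B = UNIV] by (metis infsumI)
  ultimately show ?thesis
    using that row_sums_has_sum[OF f a] by (auto dest: has_sum_imp_sums)
qed

lemma sums_antidiagonal:
  fixes f :: "nat \<times> nat \<Rightarrow> complex"
  assumes f: "f summable_on UNIV \<times> UNIV" and a: "\<And>n. (\<lambda>s. f (n, s)) sums a n"
  obtains S where "a sums S" "(\<lambda>N. \<Sum>n\<le>N. f (n, N - n)) sums S"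
proof -
  let ?S = "infsum f (UNIV \<times> UNIV)"
  have "((\<lambda>(N, n). f (n, N - n)) has_sum ?S) (Sigma UNIV (\<lambda>N. {..N}))"
  proof (subst has_sum_reindex_bij_witness[where i = "\<lambda>(n, s). (n + s, n)" and j = "\<lambda>(N, n). (n, N - n)"
        and h = f and T = "UNIV \<times> UNIV"])
    show "(f has_sum ?S) (UNIV \<times> UNIV)"
      by (rule has_sum_infsum[OF f])
  qed auto
  then have "((\<lambda>N. \<Sum>n\<le>N. f (n, N - n)) has_sum ?S) UNIV"
    by (rule has_sum_SigmaD) (auto intro: has_sum_finite)
  then show ?thesis
    using that row_sums_has_sum[OF f a] by (auto dest: has_sum_imp_sums)
qed

text \<open>The parameters \<open>a q^(n+1)\<close> and \<open>q^(n+1) / a\<close> have product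
  \<open>c = q^(2n+2)\<close>, so the factor \<open>1 - c / q\<close> of the Warnaar coefficient is
  exactly the factor \<open>1 - q^(2n+1)\<close> of \<open>slater_alpha\<close>.\<close>

lemma warnaar_term_eq:
  fixes a q :: complex
  assumes q: "norm q < 1" "q \<noteq> 0" and a: "a \<noteq> 0"
  shows "qfac q q (2 * (n + s)) * q ^ (n + s) * qpoch_inf (a * q ^ Suc (n + s)) q
      * qpoch_inf (q / a * q ^ (n + s)) q * (1 - q ^ (2 * n + 1)) / (qfac q q s * qfac q q (2 * n + s + 1))
    = q ^ n * warnaar_term q (a * q * q ^ n) (q / a * q ^ n) s"
proof -
  note ne = qfac_q_nonzero[OF q(1)]
  define c where "c = q * q ^ (2 * n + 1)"
  have c: "a * q * q ^ n * (q / a * q ^ n) = c" "c / q = q ^ (2 * n + 1)"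
    using a q(2) by (simp_all add: c_def mult_2 power_add)
  have 1: "qfac q q (2 * n + s + 1) = qfac q q (2 * n + 1) * qfac c q s"
    using qfac_add[of q q "2 * n + 1" s] by (simp add: c_def)
  have 2: "(1 - q ^ (2 * n + 1)) * qfac q q (2 * n) = qfac q q (2 * n + 1)"
    by (simp add: qfac_Suc)
  have coeff: "qfac q q (2 * (n + s)) * (1 - q ^ (2 * n + 1)) / (qfac q q s * qfac q q (2 * n + s + 1))
      = warnaar_coeff c q s"
  proof (cases s)
    case 0
    then show ?thesis
      using 2 ne[of "2 * n + 1"] by (simp add: warnaar_coeff_def mult.commute)
  next
    case (Suc t)
    then have "2 * (n + s) = 2 * n + 1 + (2 * s - 1)"
      by simp
    then have "qfac q q (2 * (n + s)) = qfac q q (2 * n + 1) * qfac c q (2 * s - 1)"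
      unfolding c_def by (simp only: qfac_add)
    then show ?thesis
      using Suc ne[of "2 * n + 1"] unfolding 1 warnaar_coeff_def c(2) by (simp add: mult.commute)
  qed
  have e: "a * q ^ Suc (n + s) = a * q * q ^ n * q ^ s" "q / a * q ^ (n + s) = q / a * q ^ n * q ^ s"
    by (simp_all add: power_add mult_ac)
  show ?thesis
    unfolding warnaar_term_def c(1) coeff[symmetric] e
    unfolding power_add[of q n s] by simp
qed

text \<open>This is \<open>(-1)^n Q^(n(n+1)/2)\<close>, with the exponent split so that it reads as
  a coefficient of \<open>ptheta\<close> at an argument multiplied by \<open>Q\<close>.\<close>

definition theta_weight :: "complex \<Rightarrow> nat \<Rightarrow> complex" where
  "theta_weight Q n = (-1) ^ n * Q ^ (n choose 2) * Q ^ n"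

lemma choose_two_double: "2 * (n choose 2) + n = n\<^sup>2"
  by (induction n) (simp_all add: choose_two_Suc power2_eq_square binomial_eq_0)

text \<open>All powers of \<open>r\<close> on the left combine to exponent
  \<open>(4k - 1) n(n+1)/2\<close>; this is where the base \<open>Q = r ^ (4 * k - 1)\<close>
  arises.\<close>

lemma slater_alpha_weight:
  assumes "k \<ge> 1"
  shows "((r\<^sup>2) ^ (n\<^sup>2 + n)) ^ (k - 1) * slater_alpha r n * (r\<^sup>2) ^ n
    = theta_weight (r ^ (4 * k - 1)) n * (1 - (r\<^sup>2) ^ (2 * n + 1))"
proof -
  obtain l where l: "k = Suc l"
    using assms by (cases k) auto
  have "2 * (n\<^sup>2 + n) * (k - 1) + (3 * (n choose 2) + n) + 2 * n = (4 * k - 1) * ((n choose 2) + n)"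
    using choose_two_double[of n, symmetric] by (simp add: l algebra_simps)
  then have "r ^ (2 * (n\<^sup>2 + n) * (k - 1)) * r ^ (3 * (n choose 2) + n) * r ^ (2 * n)
      = r ^ ((4 * k - 1) * ((n choose 2) + n))"
    by (simp only: flip: power_add)
  moreover have "((r\<^sup>2) ^ (n\<^sup>2 + n)) ^ (k - 1) = r ^ (2 * (n\<^sup>2 + n) * (k - 1))" "(r\<^sup>2) ^ n = r ^ (2 * n)"
    by (simp_all only: power_mult)
  moreover have "theta_weight (r ^ (4 * k - 1)) n = (-1) ^ n * r ^ ((4 * k - 1) * ((n choose 2) + n))"
    by (simp only: theta_weight_def distrib_left power_add power_mult mult.assoc)
  ultimately show ?thesis
    by (simp add: slater_alpha_def mult_ac)
qed

text \<open>The infinite products cancel the denominators of the summand and leave tails. Expanding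
  the inner sum by \<open>bailey_beta_eq\<close> then gives Warnaar terms with index
  \<open>s = N - n\<close>.\<close>

lemma lhs_term_eq:
  fixes r a :: complex
  assumes r: "norm r < 1" "r \<noteq> 0" and k: "k \<ge> 1"
    and a: "a \<noteq> 0" "\<And>j. a * q ^ j \<noteq> 1" "\<And>j. q / a * q ^ j \<noteq> 1" and q_def: "q = r\<^sup>2"
  shows "qpoch_inf a q * qpoch_inf (q / a) q * lhs_term q r a k N
    = (\<Sum>n\<le>N. theta_weight (r ^ (4 * k - 1)) n * warnaar_term q (a * q * q ^ n) (q / a * q ^ n) (N - n))"
proof -
  have q: "norm q < 1" "q \<noteq> 0"
    using r by (simp_all add: q_def norm_power power_less_one_iff)
  have A: "qpoch_inf a q = qfac a q (Suc N) * qpoch_inf (a * q ^ Suc N) q" "qfac a q (Suc N) \<noteq> 0"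
    "qpoch a q (int N + 1) = qfac a q (Suc N)"
    using qpoch_inf_split[OF q(1)] a(2) qpoch_eq_qfac[OF q(1) a(2), of "Suc N"] 
    by (simp_all add: qfac_eq_0_iff add.commute del: power_Suc)
  have B: "qpoch_inf (q / a) q = qfac (q / a) q N * qpoch_inf (q / a * q ^ N) q" "qfac (q / a) q N \<noteq> 0"
    "qpoch (q / a) q (int N) = qfac (q / a) q N"
    using qpoch_inf_split[OF q(1), of "q / a" N] a(3) qpoch_eq_qfac[OF q(1) a(3)] by (simp_all add: qfac_eq_0_iff)
  have C: "qpoch q q (2 * int N) = qfac q q (2 * N)"
    using qpoch_q_eq_qfac[OF q(1), of "2 * N"] by simp
  have "qpoch_inf a q * qpoch_inf (q / a) q * lhs_term q r a k N
      = qfac q q (2 * N) * q ^ N * qpoch_inf (a * q ^ Suc N) q * qpoch_inf (q / a * q ^ N) q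
        * bailey_beta r (k - 1) N"
    unfolding lhs_term_def q_def[symmetric] inner_sum_eq_bailey_beta[OF r(1) k, folded q_def] C A(3) B(3)
    unfolding A(1) B(1) using A(2) B(2) by simp
  also have "\<dots> = (\<Sum>n\<le>N. theta_weight (r ^ (4 * k - 1)) n * warnaar_term q (a * q * q ^ n) (q / a * q ^ n) (N - n))"
    unfolding bailey_beta_eq[OF r] q_def[symmetric] sum_distrib_left
  proof (intro sum.cong refl)
    fix n assume "n \<in> {..N}"
    define s where "s = N - n"
    have N: "N = n + s" "N - n = s" "N + n + 1 = 2 * n + s + 1"
      using \<open>n \<in> {..N}\<close> by (simp_all add: s_def)
    let ?X = "qfac q q (2 * (n + s)) * q ^ (n + s) * qpoch_inf (a * q ^ Suc (n + s)) q
      * qpoch_inf (q / a * q ^ (n + s)) q"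
    let ?D = "qfac q q s * qfac q q (2 * n + s + 1)"
    let ?\<alpha> = "(q ^ (n\<^sup>2 + n)) ^ (k - 1) * slater_alpha r n"
    \<comment> \<open>\<open>slater_alpha_weight\<close> needs an extra factor \<open>q ^ n\<close>,
      and \<open>warnaar_term_eq\<close> returns the same factor, so it is inserted here and
      cancelled afterwards.\<close>
    have "q ^ n * (?X * (?\<alpha> / ?D)) = ?X * (?\<alpha> * q ^ n) / ?D"
      by simp
    also have "\<dots> = theta_weight (r ^ (4 * k - 1)) n * (?X * (1 - q ^ (2 * n + 1)) / ?D)"
      unfolding slater_alpha_weight[OF k, of r n, folded q_def] by simp
    also have "\<dots> = q ^ n * (theta_weight (r ^ (4 * k - 1)) n * warnaar_term q (a * q * q ^ n) (q / a * q ^ n) s)"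
      unfolding warnaar_term_eq[OF q a(1)] by simp
    finally have "q ^ n * (?X * (?\<alpha> / ?D))
      = q ^ n * (theta_weight (r ^ (4 * k - 1)) n * warnaar_term q (a * q * q ^ n) (q / a * q ^ n) s)" .
    then have "?X * (?\<alpha> / ?D) = theta_weight (r ^ (4 * k - 1)) n * warnaar_term q (a * q * q ^ n) (q / a * q ^ n) s"
      using q(2) by (subst (asm) mult_left_cancel) auto
    then show "qfac q q (2 * N) * q ^ N * qpoch_inf (a * q ^ Suc N) q * qpoch_inf (q / a * q ^ N) q
        * (?\<alpha> / (qfac q q (N - n) * qfac q q (N + n + 1)))
      = theta_weight (r ^ (4 * k - 1)) n * warnaar_term q (a * q * q ^ n) (q / a * q ^ n) (N - n)"
      unfolding N(2,3) unfolding N(1) .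
  qed
  finally show ?thesis .
qed

lemma summable_norm_theta_weight:
  fixes Q :: complex
  assumes "norm Q < 1"
  shows "summable (\<lambda>n. norm (theta_weight Q n))"
  using summable_power_choose_two[of "norm Q" "norm Q"] assms
  by (simp add: theta_weight_def norm_mult norm_power)

text \<open>The antidiagonals of one double sum give the left-hand side, its rows Warnaar sums. It
  converges absolutely because the bound \<open>C * norm q ^ s\<close> on the Warnaar terms is
  uniform in \<open>n\<close>.\<close>

lemma lhs_sums:
  fixes r a :: complex
  assumes r: "norm r < 1" "r \<noteq> 0" and k: "k \<ge> 1"
    and a: "a \<noteq> 0" "\<And>j. a * q ^ j \<noteq> 1" "\<And>j. q / a * q ^ j \<noteq> 1" and q_def: "q = r\<^sup>2"
  obtains S where "(\<lambda>N. qpoch_inf q q * qpoch_inf a q * qpoch_inf (q / a) q * lhs_term q r a k N) sums S"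
    and "(\<lambda>n. theta_weight (r ^ (4 * k - 1)) n * (ptheta q (a * q * q ^ n) + ptheta q (q / a * q ^ n) - 1)) sums S"
proof -
  have q: "norm q < 1" "q \<noteq> 0"
    using r by (simp_all add: q_def norm_power power_less_one_iff)
  have Q: "norm (r ^ (4 * k - 1)) < 1"
    using r k by (simp add: norm_power power_less_one_iff)
  have ab: "a * q * (q / a) * q ^ j \<noteq> 1" for j
    using norm_less_1_power_neq_1[OF q(1) q(1), of "Suc j"] a(1) by (simp add: mult_ac)
  have abn: "a * q * q ^ n * (q / a * q ^ n) * q ^ j \<noteq> 1" for n j
    using ab[of "n + n + j"] by (simp only: power_add mult.assoc mult.left_commute mult.commute not_False_eq_True)
  let ?w = "theta_weight (r ^ (4 * k - 1))"
  let ?f = "\<lambda>(n, s). ?w n * warnaar_term q (a * q * q ^ n) (q / a * q ^ n) s"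
  obtain C where C: "C > 0" "\<And>n s. norm (warnaar_term q (a * q * q ^ n) (q / a * q ^ n) s) \<le> C * norm q ^ s"
    using norm_warnaar_term_bounded[OF q(1) ab] by blast
  have "?f summable_on UNIV \<times> UNIV"
  proof (rule summable_on_product_bound)
    show "norm (?f (n, s)) \<le> norm (?w n) * (C * norm q ^ s)" for n s
      using C(2) by (simp add: norm_mult mult_left_mono)
    show "(\<lambda>n. norm (?w n)) summable_on UNIV"
      using summable_norm_theta_weight[OF Q] by (intro norm_summable_imp_summable_on) simp
    show "(\<lambda>s. C * norm q ^ s) summable_on UNIV"
      using q C(1) by (intro norm_summable_imp_summable_on) (simp add: abs_mult summable_mult summable_geometric)
  qed (use C in auto)
  moreover have "(\<lambda>s. ?f (n, s)) sums (?w n * warnaar_sum q (a * q * q ^ n) (q / a * q ^ n))" for n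
    unfolding warnaar_sum_def prod.case
    by (intro sums_mult summable_sums summable_norm_cancel[OF summable_warnaar_term[OF q(1) abn]])
  ultimately obtain S where S: "(\<lambda>n. ?w n * warnaar_sum q (a * q * q ^ n) (q / a * q ^ n)) sums S"
    "(\<lambda>N. \<Sum>n\<le>N. ?f (n, N - n)) sums S"
    by (rule sums_antidiagonal)
  from sums_mult[OF S(2), of "qpoch_inf q q"]
  have 1: "(\<lambda>N. qpoch_inf q q * qpoch_inf a q * qpoch_inf (q / a) q * lhs_term q r a k N) sums (qpoch_inf q q * S)"
    unfolding prod.case lhs_term_eq[OF assms, symmetric] by (simp only: mult.assoc)
  from sums_mult[OF S(1), of "qpoch_inf q q"]
  have 2: "(\<lambda>n. ?w n * (ptheta q (a * q * q ^ n) + ptheta q (q / a * q ^ n) - 1)) sums (qpoch_inf q q * S)"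
    unfolding warnaar_sum_eq_ptheta[OF q abn, symmetric] by (simp only: mult.left_commute)
  show ?thesis
    by (rule that[OF 1 2])
qed

section \<open>Theta products and quasi-periodicity\<close>

definition theta_prod :: "complex \<Rightarrow> complex \<Rightarrow> complex" where
  "theta_prod q z = qpoch_inf z q * qpoch_inf (q / z) q * qpoch_inf q q"

lemma theta_prod_eq_ptheta:
  fixes q z :: complex
  assumes "norm q < 1" "q \<noteq> 0" "z \<noteq> 0"
  shows "theta_prod q z = ptheta q z + ptheta q (q / z) - 1"
  unfolding theta_prod_def by (rule jacobi_triple_product[OF assms])

lemma theta_prod_symmetric:
  fixes q z :: complex
  assumes "q \<noteq> 0"
  shows "theta_prod q (q / z) = theta_prod q z"
  using assms by (simp add: theta_prod_def)

lemma theta_prod_mult: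
  fixes q z :: complex
  assumes q: "norm q < 1" "q \<noteq> 0" and z: "z \<noteq> 0"
  shows "theta_prod q (z * q) = - (theta_prod q z / z)"
proof -
  have 1: "qpoch_inf z q = (1 - z) * qpoch_inf (z * q) q"
    using qpoch_inf_split[OF q(1), of z 1] by (simp add: qfac_def)
  have 2: "qpoch_inf (1 / z) q = (1 - 1 / z) * qpoch_inf (q / z) q"
    using qpoch_inf_split[OF q(1), of "1 / z" 1] by (simp add: qfac_def)
  have 3: "1 - 1 / z = - ((1 - z) / z)"
    using z by (simp add: field_simps)
  have "q / (z * q) = 1 / z"
    using q by simp
  then show ?thesis
    unfolding theta_prod_def 1 using 2 3 by simp
qed

lemma theta_prod_mult_power:
  fixes q z :: complex
  assumes q: "norm q < 1" "q \<noteq> 0" and z: "z \<noteq> 0"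
  shows "theta_prod q (z * q ^ n) = (-1) ^ n * theta_prod q z / (z ^ n * q ^ (n choose 2))"
proof (induction n)
  case 0
  then show ?case
    by (simp add: binomial_eq_0)
next
  case (Suc n)
  have "theta_prod q (z * q ^ Suc n) = theta_prod q (z * q ^ n * q)"
    by (simp add: mult_ac)
  also have "\<dots> = - (theta_prod q (z * q ^ n) / (z * q ^ n))"
    using q z by (intro theta_prod_mult) auto
  finally show ?case
    unfolding Suc by (simp add: choose_two_Suc power_add mult_ac)
qed

text \<open>
  Absolute convergence of the double sum below: since
  \<open>m(m-1)/2 - mn = l(l-1)/2 - n(n+1)/2\<close> for \<open>l = m - n\<close>, its terms factor as a function of
  \<open>n\<close> times a function of the integer \<open>l\<close>.
\<close>

lemma summable_on_int_quadratic:
  fixes \<alpha> \<rho> :: real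
  assumes "0 < \<alpha>" "0 < \<rho>" "\<rho> < 1"
  shows "(\<lambda>l::int. \<alpha> powi l * \<rho> powi (l * (l - 1))) summable_on UNIV"
proof -
  let ?h = "\<lambda>l::int. \<alpha> powi l * \<rho> powi (l * (l - 1))"
  have c2: "int n * (int n - 1) = int (2 * (n choose 2))" for n
    using choose_two_double[of n] by (simp add: algebra_simps power2_eq_square flip: of_nat_mult of_nat_add)
  have \<rho>2: "\<rho>\<^sup>2 < 1"
    using assms by (simp add: power_less_one_iff)
  have pos: "?h (int n) = (\<rho>\<^sup>2) ^ (n choose 2) * \<alpha> ^ n" for n
    unfolding c2 power_int_of_nat by (simp add: power_mult mult.commute)
  have neg: "?h (- 1 - int n) = (\<rho>\<^sup>2 / \<alpha>) * ((\<rho>\<^sup>2) ^ (n choose 2) * (\<rho> ^ 4 / \<alpha>) ^ n)" for n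
  proof -
    have "(- 1 - int n) * (- 1 - int n - 1) = int n * (int n - 1) + int (4 * n + 2)"
      by (simp add: algebra_simps)
    also have "\<dots> = int (2 * (n choose 2) + (4 * n + 2))"
      unfolding c2 by simp
    finally have 1: "\<rho> powi ((- 1 - int n) * (- 1 - int n - 1)) = (\<rho>\<^sup>2) ^ (n choose 2) * ((\<rho> ^ 4) ^ n * \<rho>\<^sup>2)"
      by (simp only: power_int_of_nat power_add power_mult)
    have "- 1 - int n = - int (Suc n)"
      by simp
    then have 2: "\<alpha> powi (- 1 - int n) = 1 / (\<alpha> * \<alpha> ^ n)"
      by (simp only: power_int_minus power_int_of_nat power_Suc inverse_eq_divide)
    show ?thesis
      unfolding 1 2 by (simp add: power_divide)
  qed
  have "?h summable_on range int"
  proof (subst summable_on_reindex)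
    show "?h \<circ> int summable_on UNIV"
      unfolding o_def pos
      by (intro norm_summable_imp_summable_on)
         (use summable_power_choose_two[of "\<rho>\<^sup>2" \<alpha>] \<rho>2 assms in \<open>simp add: abs_mult\<close>)
  qed (simp add: inj_on_def)
  moreover have "?h summable_on range (\<lambda>n. - 1 - int n)"
  proof (subst summable_on_reindex)
    show "?h \<circ> (\<lambda>n. - 1 - int n) summable_on UNIV"
      unfolding o_def neg
      by (intro summable_on_cmult_right norm_summable_imp_summable_on)
         (use summable_power_choose_two[of "\<rho>\<^sup>2" "\<rho> ^ 4 / \<alpha>"] \<rho>2 assms in \<open>simp add: abs_mult\<close>)
  qed (simp add: inj_on_def)
  ultimately have "?h summable_on (range int \<union> range (\<lambda>n. - 1 - int n))"
    by (rule summable_on_Un_disjoint) auto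
  also have "range int \<union> range (\<lambda>n. - 1 - int n) = UNIV"
  proof -
    have "x \<in> range int \<union> range (\<lambda>n. - 1 - int n)" for x
    proof (cases "x \<ge> 0")
      case True
      then show ?thesis
        by (metis UnI1 nat_0_le rangeI)
    next
      case False
      then have "x = - 1 - int (nat (- 1 - x))"
        by simp
      then show ?thesis
        by blast
    qed
    then show ?thesis
      by blast
  qed
  finally show ?thesis .
qed

lemma theta_double_sum_summable:
  fixes r a :: complex
  assumes r: "norm r < 1" "r \<noteq> 0" and K: "K \<ge> 3" and a: "a \<noteq> 0"
  shows "(\<lambda>(n, m). theta_weight (r ^ K) n * ((-1) ^ m * (r\<^sup>2) ^ (m choose 2) * (a / (r\<^sup>2) ^ n) ^ m))
    summable_on UNIV \<times> UNIV"
proof -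
  \<comment> \<open>The factor \<open>q^(-n(n+1)/2)\<close> has norm \<rho>\<open>^(-n(n+1))\<close>
    and uses up two of the \<open>K\<close> powers in the theta weight; \<open>L = K - 2 > 0\<close>
    is what keeps \<open>g\<close> summable.\<close>
  obtain L where L: "K = L + 2" "L > 0"
    using K by (metis add.commute le_Suc_ex less_eq_Suc_le numeral_2_eq_2 numeral_3_eq_3 add_Suc_right add_Suc plus_1_eq_Suc zero_less_Suc add_2_eq_Suc')
  define \<rho> \<alpha> where "\<rho> = norm r" and "\<alpha> = norm a"
  have pos: "0 < \<rho>" "\<rho> < 1" "0 < \<alpha>"
    using r a by (simp_all add: \<rho>_def \<alpha>_def)
  then have ne: "\<rho> \<noteq> 0"
    by simp
  define g where "g n = (\<rho> ^ L) ^ (n choose 2) * (\<rho> ^ L * \<alpha>) ^ n" for n :: nat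
  define h where "h l = \<alpha> powi l * \<rho> powi (l * (l - 1))" for l :: int
  let ?f = "\<lambda>(n, m). theta_weight (r ^ K) n * ((-1) ^ m * (r\<^sup>2) ^ (m choose 2) * (a / (r\<^sup>2) ^ n) ^ m)"
  have c2: "int n * (int n - 1) = 2 * int (n choose 2)" for n
    using choose_two_double[of n] by (simp add: algebra_simps power2_eq_square flip: of_nat_mult of_nat_add)
  have norm_f: "norm (?f (n, m)) = g n * h (int m - int n)" for n m
  proof -
    have "norm (?f (n, m)) = \<alpha> ^ m * (\<rho> ^ (K * ((n choose 2) + n) + 2 * (m choose 2)) / \<rho> ^ (2 * n * m))"
      by (simp add: theta_weight_def norm_mult norm_power norm_divide \<rho>_def \<alpha>_def power_divide distrib_left
           power_add power_mult)
    also have "\<rho> ^ (K * ((n choose 2) + n) + 2 * (m choose 2)) / \<rho> ^ (2 * n * m)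
        = \<rho> powi (int (K * ((n choose 2) + n) + 2 * (m choose 2)) - int (2 * n * m))"
      by (simp only: power_int_diff[OF disjI1[OF ne]] power_int_of_nat)
    also have "int (K * ((n choose 2) + n) + 2 * (m choose 2)) - int (2 * n * m)
        = int (L * (n choose 2) + L * n) + (int m - int n) * (int m - int n - 1)"
      using c2[of n] c2[of m] by (simp add: L algebra_simps)
    also have "\<rho> powi \<dots> = \<rho> ^ (L * (n choose 2) + L * n) * \<rho> powi ((int m - int n) * (int m - int n - 1))"
      by (simp only: power_int_add[OF disjI1[OF ne]] power_int_of_nat)
    also have "\<alpha> ^ m = \<alpha> ^ n * \<alpha> powi (int m - int n)"
      using pos by (simp add: power_int_diff)
    finally show ?thesis
      by (simp add: g_def h_def power_add power_mult power_mult_distrib mult_ac)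
  qed
  have "g summable_on UNIV"
  proof -
    have "\<rho> ^ L < 1"
      using pos L by (simp add: power_less_one_iff)
    then show ?thesis
      unfolding g_def
      by (intro norm_summable_imp_summable_on)
         (use summable_power_choose_two[of "\<rho> ^ L" "\<rho> ^ L * \<alpha>"] pos in \<open>simp add: abs_mult\<close>)
  qed
  moreover have "h summable_on UNIV"
    unfolding h_def by (rule summable_on_int_quadratic) (use pos in auto)
  moreover have "0 \<le> g n" "0 \<le> h l" for n l
    using pos by (simp_all add: g_def h_def)
  ultimately have "(\<lambda>(n, l). g n * h l) summable_on UNIV \<times> UNIV"
    by (intro summable_on_real_product)
  \<comment> \<open>The substitution \<open>l = m - n\<close> maps the pairs injectively into pairs
    of a natural number and an integer, so a partial sum of the product suffices.\<close>
  then have "(\<lambda>(n, l). g n * h l) summable_on (\<lambda>(n, m). (n, int m - int n)) ` (UNIV \<times> UNIV)"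
    by (rule summable_on_subset_banach) auto
  then have "(\<lambda>z. norm (?f z)) summable_on UNIV \<times> UNIV"
    by (subst (asm) summable_on_reindex) (auto simp: inj_on_def o_def case_prod_unfold norm_f[unfolded prod.case])
  then show ?thesis
    by (rule abs_summable_summable)
qed

lemma ptheta_weight_sums:
  fixes Q x :: complex
  assumes "norm Q < 1"
  shows "(\<lambda>n. theta_weight Q n * x ^ n) sums ptheta Q (Q * x)"
  using ptheta_sums[OF assms, of "Q * x"]
  by (simp add: theta_weight_def power_mult_distrib mult_ac)

lemma theta_swap:
  fixes r a :: complex
  assumes r: "norm r < 1" "r \<noteq> 0" and K: "K \<ge> 3" and a: "a \<noteq> 0" and q_def: "q = r\<^sup>2"
  obtains S where
    "(\<lambda>n. theta_weight (r ^ K) n * (ptheta q (a / q ^ n) - ptheta q (a * q * q ^ n))) sums S"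
    "(\<lambda>m. (-1) ^ m * q ^ (m choose 2) * a ^ m * theta_prod (r ^ K) (q ^ m)) sums S"
proof -
  define Q where "Q = r ^ K"
  have q: "norm q < 1" "q \<noteq> 0"
    using r by (simp_all add: q_def norm_power power_less_one_iff)
  have Q: "norm Q < 1" "Q \<noteq> 0"
    using r K by (simp_all add: Q_def norm_power power_less_one_iff)
  let ?t = "\<lambda>m x. (-1) ^ m * q ^ (m choose 2) * x ^ m"
  let ?f1 = "\<lambda>(n, m). theta_weight Q n * ?t m (a / q ^ n)"
  let ?f2 = "\<lambda>(n, m). theta_weight Q n * ?t m (a * q * q ^ n)"
  have s1: "?f1 summable_on UNIV \<times> UNIV"
    using theta_double_sum_summable[OF r K a] by (simp add: Q_def q_def)
  have s2: "?f2 summable_on UNIV \<times> UNIV"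
  proof (rule summable_on_product_bound)
    show "norm (?f2 (n, m)) \<le> norm (theta_weight Q n) * (norm q ^ (m choose 2) * norm (a * q) ^ m)" for n m
    proof -
      have "norm (?t m (a * q * q ^ n)) = norm q ^ (m choose 2) * norm (a * q * q ^ n) ^ m"
        by (simp add: norm_mult norm_power)
      also have "\<dots> \<le> norm q ^ (m choose 2) * norm (a * q) ^ m"
        by (intro mult_left_mono power_mono norm_mult_power_le q) auto
      finally show ?thesis
        unfolding prod.case norm_mult[of "theta_weight Q n"] by (intro mult_left_mono) auto
    qed
    show "(\<lambda>n. norm (theta_weight Q n)) summable_on UNIV"
      using summable_norm_theta_weight[OF Q(1)] by (intro norm_summable_imp_summable_on) simp
    show "(\<lambda>m. norm q ^ (m choose 2) * norm (a * q) ^ m) summable_on UNIV"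
      using summable_power_choose_two[of "norm q" "norm (a * q)"] q
      by (intro norm_summable_imp_summable_on) (simp add: norm_mult)
  qed auto
  have "(\<lambda>z. ?f1 z - ?f2 z) summable_on UNIV \<times> UNIV"
    using summable_on_add[OF s1 summable_on_cmult_right[OF s2, of "-1"]] by simp
  moreover have "(\<lambda>m. ?f1 (n, m) - ?f2 (n, m)) sums (theta_weight Q n * (ptheta q (a / q ^ n) - ptheta q (a * q * q ^ n)))" for n
    unfolding prod.case right_diff_distrib by (intro sums_diff sums_mult ptheta_sums q)
  moreover have "(\<lambda>n. ?f1 (n, m) - ?f2 (n, m)) sums (?t m a * theta_prod Q (q ^ m))" for m
  proof -
    have "(\<lambda>n. ?t m a * (theta_weight Q n * (1 / q ^ m) ^ n - q ^ m * (theta_weight Q n * (q ^ m) ^ n)))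
        sums (?t m a * (ptheta Q (Q * (1 / q ^ m)) - q ^ m * ptheta Q (Q * q ^ m)))"
      by (intro sums_diff sums_mult ptheta_weight_sums Q)
    moreover have "?t m a * (theta_weight Q n * (1 / q ^ m) ^ n - q ^ m * (theta_weight Q n * (q ^ m) ^ n))
        = ?f1 (n, m) - ?f2 (n, m)" for n
    proof -
      have "(q ^ n) ^ m = (q ^ m) ^ n"
        by (simp add: mult.commute flip: power_mult)
      then show ?thesis
        by (simp add: power_divide power_mult_distrib right_diff_distrib)
    qed
    moreover have "ptheta Q (Q * (1 / q ^ m)) - q ^ m * ptheta Q (Q * q ^ m) = theta_prod Q (q ^ m)"
      using theta_prod_eq_ptheta[OF Q, of "q ^ m"] ptheta_shift[OF Q(1), of "q ^ m"] q by (simp add: mult_ac)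
    ultimately show ?thesis
      by (simp only:)
  qed
  ultimately obtain S where "(\<lambda>n. theta_weight Q n * (ptheta q (a / q ^ n) - ptheta q (a * q * q ^ n))) sums S"
    "(\<lambda>m. ?t m a * theta_prod Q (q ^ m)) sums S"
    by (rule sums_swap)
  then show ?thesis
    using that unfolding Q_def by blast
qed

section \<open>The right-hand side\<close>

lemma half_pow_eq_power:
  assumes "2 * s = real N"
  shows "half_pow r s = r ^ N"
proof -
  have "\<lfloor>2 * s\<rfloor> = int N"
    using assms by simp
  then show ?thesis
    by (simp add: half_pow_def)
qed

lemma two_kappa:
  assumes "k \<ge> 1"
  shows "2 * kappa k = real (4 * k - 1)"
  using assms by (simp add: kappa_def of_nat_diff)

lemma two_kappa_minus_1:
  assumes "k \<ge> 1"
  shows "2 * (kappa k - 1) = real (4 * k - 3)"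
  using assms by (simp add: kappa_def of_nat_diff)

lemma two_int_choose_two: "2 * int (n choose 2) = int n * (int n - 1)"
  using choose_two_double[of n] by (simp add: algebra_simps power2_eq_square flip: of_nat_mult of_nat_add)

lemma partial_theta_term_eq:
  assumes "k \<ge> 1"
  shows "partial_theta_term r a k n = a ^ n * r ^ ((4 * k - 3) * ((n choose 2) + n))"
proof -
  have "2 * ((kappa k - 1) * real ((n + 1) choose 2)) = real ((4 * k - 3) * ((n choose 2) + n))"
    using two_kappa_minus_1[OF assms] by (simp add: choose_two_Suc mult.assoc[symmetric])
  then show ?thesis
    unfolding partial_theta_term_def by (simp only: half_pow_eq_power)
qed

lemma rhs_term_eq:
  assumes k: "k \<ge> 1" and i: "i \<le> 2 * k - 1" and K: "K = 4 * k - 1" and L: "L = 4 * k - 3"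
  shows "rhs_term r a k i n = (- 1) ^ n * a ^ (K * n) * r ^ (L * (K * n + 2 * i) * n)
     * (1 + a ^ (K - 2 * i) * r ^ (L * (K - 2 * i) * (2 * n + 1)))"
proof -
  have \<kappa>: "2 * kappa k = real K" "2 * (kappa k - 1) = real L"
    using two_kappa[OF k] two_kappa_minus_1[OF k] by (simp_all add: K L)
  have d: "2 * kappa k - 2 * real i = real (K - 2 * i)"
    using \<kappa> i by (simp add: K of_nat_diff)
  have "\<lfloor>2 * kappa k * real n\<rfloor> = int (K * n)"
    unfolding \<kappa> of_nat_mult[symmetric] by (rule floor_of_nat)
  moreover have "\<lfloor>2 * kappa k - 2 * real i\<rfloor> = int (K - 2 * i)"
    unfolding d by (rule floor_of_nat)
  moreover have "half_pow r (2 * (kappa k - 1) * (kappa k * real n + real i) * real n) = r ^ (L * (K * n + 2 * i) * n)"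
  proof (intro half_pow_eq_power)
    have "2 * (2 * (kappa k - 1) * (kappa k * real n + real i) * real n)
        = (2 * (kappa k - 1)) * (2 * kappa k * real n + 2 * real i) * real n"
      by (simp add: algebra_simps)
    also have "\<dots> = real (L * (K * n + 2 * i) * n)"
      unfolding \<kappa> by simp
    finally show "2 * (2 * (kappa k - 1) * (kappa k * real n + real i) * real n) = real (L * (K * n + 2 * i) * n)" .
  qed
  moreover have "half_pow r (2 * (kappa k - 1) * (kappa k - real i) * (2 * real n + 1)) = r ^ (L * (K - 2 * i) * (2 * n + 1))"
  proof (intro half_pow_eq_power)
    have "2 * (2 * (kappa k - 1) * (kappa k - real i) * (2 * real n + 1))
        = (2 * (kappa k - 1)) * (2 * kappa k - 2 * real i) * (2 * real n + 1)"
      by (simp add: algebra_simps)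
    also have "\<dots> = real (L * (K - 2 * i) * (2 * n + 1))"
      unfolding \<kappa>(2) d by (simp add: distrib_left)
    finally show "2 * (2 * (kappa k - 1) * (kappa k - real i) * (2 * real n + 1)) = real (L * (K - 2 * i) * (2 * n + 1))" .
  qed
  ultimately show ?thesis
    unfolding rhs_term_def by (simp only: power_int_of_nat)
qed

lemma summable_rhs_term:
  fixes r a :: complex
  assumes r: "norm r < 1" and k: "k \<ge> 1" and i: "i \<le> 2 * k - 1"
  shows "summable (rhs_term r a k i)"
proof -
  define K L where "K = 4 * k - 1" and "L = 4 * k - 3"
  have pos: "K > 0" "L > 0"
    using k by (simp_all add: K_def L_def)
  define \<rho> \<alpha> where "\<rho> = norm r" and "\<alpha> = norm a"
  have "\<rho> ^ (2 * L * K) < 1"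
    using r pos by (simp add: \<rho>_def power_less_one_iff)
  then have "summable (\<lambda>n. (1 + \<alpha> ^ (K - 2 * i)) * ((\<rho> ^ (2 * L * K)) ^ (n choose 2) * (\<alpha> ^ K * \<rho> ^ (L * K + 2 * L * i)) ^ n))"
    by (intro summable_mult summable_power_choose_two) (auto simp: \<rho>_def \<alpha>_def)
  moreover have "norm (rhs_term r a k i n)
      \<le> (1 + \<alpha> ^ (K - 2 * i)) * ((\<rho> ^ (2 * L * K)) ^ (n choose 2) * (\<alpha> ^ K * \<rho> ^ (L * K + 2 * L * i)) ^ n)" for n
  proof -
    have "L * (K * n + 2 * i) * n = L * K * n\<^sup>2 + 2 * L * i * n"
      by (simp add: power2_eq_square algebra_simps)
    then have e: "L * (K * n + 2 * i) * n = 2 * L * K * (n choose 2) + (L * K + 2 * L * i) * n"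
      unfolding choose_two_double[of n, symmetric] by (simp add: algebra_simps)
    have "norm (1 + a ^ (K - 2 * i) * r ^ (L * (K - 2 * i) * (2 * n + 1))) \<le> 1 + \<alpha> ^ (K - 2 * i) * 1"
      using r by (intro norm_triangle_le add_mono)
        (auto simp: norm_mult norm_power \<alpha>_def mult_left_le power_le_one)
    then have "norm (rhs_term r a k i n) \<le> \<alpha> ^ (K * n) * \<rho> ^ (L * (K * n + 2 * i) * n) * (1 + \<alpha> ^ (K - 2 * i) * 1)"
      unfolding rhs_term_eq[OF k i K_def L_def] norm_mult norm_power \<rho>_def \<alpha>_def by (intro mult_mono) auto
    then show ?thesis
      unfolding e power_add[of \<rho> "2 * L * K * (n choose 2)"] power_mult[of \<rho> "2 * L * K"]
        power_mult[of \<rho> "L * K + 2 * L * i"] power_mult[of \<alpha> K] power_mult_distrib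
      by (simp only: mult_ac mult_1_left mult_1_right)
  qed
  ultimately show ?thesis
    by (rule summable_comparison_test'[of _ 0])
qed

lemma theta_exponent_low:
  fixes K L i n :: nat
  assumes "K = L + 2"
  shows "2 * ((n * K + i) choose 2)
    = 4 * i * n + K * ((2 * n) choose 2) + 2 * (i choose 2) + L * (K * n + 2 * i) * n"
proof -
  have "2 * (2 * c1) = 2 * (4 * i * n + K * c2 + 2 * c3 + L * (K * n + 2 * i) * n)"
    if "2 * c1 = (n * K + i) * (n * K + i - 1)" "2 * c2 = 2 * n * (2 * n - 1)" "2 * c3 = i * (i - 1)" "K = L + 2"
    for c1 c2 c3 i n K L :: int
  proof -
    have "2 * (4 * i * n + K * c2 + 2 * c3 + L * (K * n + 2 * i) * n)
        = 8 * i * n + K * (2 * c2) + 2 * (2 * c3) + 2 * L * (K * n + 2 * i) * n"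
      by (simp add: algebra_simps)
    also have "\<dots> = 2 * (2 * c1)"
      unfolding that by (simp add: algebra_simps)
    finally show ?thesis ..
  qed
  from this[of "int ((n * K + i) choose 2)" "int n" "int K" "int i" "int ((2 * n) choose 2)" "int (i choose 2)" "int L"]
  have "2 * (2 * int ((n * K + i) choose 2))
    = 2 * (4 * int i * int n + int K * int ((2 * n) choose 2) + 2 * int (i choose 2)
      + int L * (int K * int n + 2 * int i) * int n)"
    using two_int_choose_two[of "n * K + i"] two_int_choose_two[of "2 * n"] two_int_choose_two[of i]
      arg_cong[OF assms, of int]
    by (simp only: of_nat_add of_nat_mult of_nat_numeral of_nat_1)
  then have "int (2 * ((n * K + i) choose 2))
    = int (4 * i * n + K * ((2 * n) choose 2) + 2 * (i choose 2) + L * (K * n + 2 * i) * n)"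
    by (simp only: of_nat_add of_nat_mult of_nat_numeral of_nat_1 mult_cancel_left) simp
  then show ?thesis
    by (simp only: of_nat_eq_iff)
qed

lemma theta_exponent_high:
  fixes K L i n d :: nat
  assumes "K = L + 2" and "K = 2 * i + d"
  shows "2 * ((n * K + (i + d)) choose 2)
    = d * (2 * n + 1) + K * ((2 * n + 1) choose 2) + 2 * (i choose 2)
      + L * (K * n + 2 * i) * n + L * d * (2 * n + 1)"
proof -
  have "2 * (2 * c1) = 2 * (d * (2 * n + 1) + K * c2 + 2 * c3 + L * (K * n + 2 * i) * n + L * d * (2 * n + 1))"
    if "2 * c1 = (n * K + (i + d)) * (n * K + (i + d) - 1)" "2 * c2 = (2 * n + 1) * (2 * n + 1 - 1)"
      "2 * c3 = i * (i - 1)" "K = L + 2" "K = 2 * i + d"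
    for c1 c2 c3 i n d K L :: int
  proof -
    have L: "L = K - 2" and d: "d = K - 2 * i"
      using that(4,5) by linarith+
    have "2 * (d * (2 * n + 1) + K * c2 + 2 * c3 + L * (K * n + 2 * i) * n + L * d * (2 * n + 1))
        = 2 * d * (2 * n + 1) + K * (2 * c2) + 2 * (2 * c3) + 2 * L * (K * n + 2 * i) * n + 2 * L * d * (2 * n + 1)"
      by (simp add: algebra_simps)
    also have "\<dots> = 2 * (2 * c1)"
      unfolding that(1,2,3) L d by (simp add: algebra_simps)
    finally show ?thesis ..
  qed
  note key = this
  have "2 * (2 * int ((n * K + (i + d)) choose 2))
    = 2 * (int d * (2 * int n + 1) + int K * int ((2 * n + 1) choose 2) + 2 * int (i choose 2)
      + int L * (int K * int n + 2 * int i) * int n + int L * int d * (2 * int n + 1))"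
  proof (rule key)
    show "2 * int ((n * K + (i + d)) choose 2)
        = (int n * int K + (int i + int d)) * (int n * int K + (int i + int d) - 1)"
      unfolding two_int_choose_two of_nat_add of_nat_mult ..
    show "2 * int ((2 * n + 1) choose 2) = (2 * int n + 1) * (2 * int n + 1 - 1)"
      unfolding two_int_choose_two by simp
    show "int K = int L + 2"
      unfolding assms(1) by simp
    show "int K = 2 * int i + int d"
      unfolding assms(2) by simp
  qed (rule two_int_choose_two)
  then have "int (2 * ((n * K + (i + d)) choose 2))
    = int (d * (2 * n + 1) + K * ((2 * n + 1) choose 2) + 2 * (i choose 2)
      + L * (K * n + 2 * i) * n + L * d * (2 * n + 1))"
    by (simp only: of_nat_add of_nat_mult of_nat_numeral of_nat_1 mult_cancel_left) simp
  then show ?thesis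
    by (simp only: of_nat_eq_iff)
qed

lemma theta_block:
  fixes r a :: complex
  assumes r: "norm r < 1" "r \<noteq> 0" and k: "k \<ge> 1" and i: "1 \<le> i" "i \<le> 2 * k - 1"
    and q_def: "q = r\<^sup>2" and K_def: "K = 4 * k - 1"
  defines "x \<equiv> \<lambda>m. (-1) ^ m * q ^ (m choose 2) * a ^ m * theta_prod (r ^ K) (q ^ m)"
  shows "x (n * K + i) + x (n * K + (K - i))
    = (- 1) ^ i * a ^ i * q ^ (i choose 2) * theta_prod (r ^ K) (q ^ i) * rhs_term r a k i n"
proof -
  define L d Q where "L = 4 * k - 3" and "d = K - 2 * i" and "Q = r ^ K"
  have K: "K = L + 2" "K = 2 * i + d" "K - i = i + d" "odd K" "K > 0"
    using k i by (auto simp: L_def d_def K_def)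
  have Q: "norm Q < 1" "Q \<noteq> 0"
    using r K(5) by (simp_all add: Q_def norm_power power_less_one_iff)
  have q: "q \<noteq> 0"
    using r by (simp add: q_def)
  define T where "T = theta_prod Q (q ^ i)"
  define e where "e = L * (K * n + 2 * i) * n"
  have sgn: "(-1) ^ (n * K + m) = (-1) ^ n * ((-1) ^ m :: complex)" for m
    using K(4) by (simp add: power_add power_mult mult.commute[of n])
  have low: "x (n * K + i) = (- 1) ^ i * a ^ i * q ^ (i choose 2) * T * ((- 1) ^ n * a ^ (K * n) * r ^ e)"
  proof -
    let ?D = "4 * i * n + K * ((2 * n) choose 2)"
    have "q ^ (n * K + i) = q ^ i * Q ^ (2 * n)"
      by (simp add: Q_def q_def power_add mult_ac flip: power_mult)
    then have "theta_prod Q (q ^ (n * K + i)) = T / ((q ^ i) ^ (2 * n) * Q ^ ((2 * n) choose 2))"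
      using theta_prod_mult_power[OF Q, of "q ^ i" "2 * n"] q by (simp add: T_def)
    also have "(q ^ i) ^ (2 * n) * Q ^ ((2 * n) choose 2) = r ^ ?D"
      by (simp add: q_def Q_def power_add mult_ac flip: power_mult)
    finally have t: "theta_prod Q (q ^ (n * K + i)) = T / r ^ ?D" .
    have "q ^ ((n * K + i) choose 2) = r ^ (?D + 2 * (i choose 2) + e)"
      unfolding q_def power_mult[symmetric] e_def theta_exponent_low[OF K(1)] ..
    also have "\<dots> = r ^ ?D * (q ^ (i choose 2) * r ^ e)"
      by (simp add: power_add q_def power_mult mult_ac)
    finally have c: "q ^ ((n * K + i) choose 2) = r ^ ?D * (q ^ (i choose 2) * r ^ e)" .
    show ?thesis
      unfolding x_def Q_def[symmetric] t c sgn using r(2) by (simp add: power_add mult_ac)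
  qed
  have high: "x (n * K + (i + d)) = (- 1) ^ i * a ^ i * q ^ (i choose 2) * T
      * ((- 1) ^ n * a ^ (K * n) * r ^ e * (a ^ d * r ^ (L * d * (2 * n + 1))))"
  proof -
    let ?D = "d * (2 * n + 1) + K * ((2 * n + 1) choose 2)"
    have Qq: "Q / q ^ i = r ^ d"
      using r(2) by (simp add: Q_def q_def K(2) power_add flip: power_mult)
    have "2 * (n * K + (i + d)) = d + K * (2 * n + 1)"
      using K(2) by (simp add: algebra_simps)
    then have "q ^ (n * K + (i + d)) = (Q / q ^ i) * Q ^ (2 * n + 1)"
      unfolding Qq unfolding Q_def q_def power_mult[symmetric] power_add[symmetric]
      by (simp only:)
    then have "theta_prod Q (q ^ (n * K + (i + d)))
        = - (theta_prod Q (Q / q ^ i) / ((Q / q ^ i) ^ (2 * n + 1) * Q ^ ((2 * n + 1) choose 2)))"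
      using theta_prod_mult_power[OF Q, of "Q / q ^ i" "2 * n + 1"] q Q(2) by simp
    also have "theta_prod Q (Q / q ^ i) = T"
      unfolding T_def by (rule theta_prod_symmetric[OF Q(2)])
    also have "(Q / q ^ i) ^ (2 * n + 1) * Q ^ ((2 * n + 1) choose 2) = r ^ ?D"
      unfolding Qq unfolding Q_def power_mult[symmetric] power_add[symmetric] ..
    finally have t: "theta_prod Q (q ^ (n * K + (i + d))) = - (T / r ^ ?D)" .
    have "q ^ ((n * K + (i + d)) choose 2) = r ^ (?D + 2 * (i choose 2) + e + L * d * (2 * n + 1))"
      unfolding q_def power_mult[symmetric] e_def theta_exponent_high[OF K(1,2)] ..
    also have "\<dots> = r ^ ?D * (q ^ (i choose 2) * (r ^ e * r ^ (L * d * (2 * n + 1))))"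
      by (simp only: power_add[of r "_ + e"] power_add[of r _ e] power_add[of r ?D] q_def power_mult[of r 2] mult.assoc)
    finally have c: "q ^ ((n * K + (i + d)) choose 2)
        = r ^ ?D * (q ^ (i choose 2) * (r ^ e * r ^ (L * d * (2 * n + 1))))" .
    have "odd d"
      using K(2,4) by simp
    then have s: "(-1) ^ (i + d) = - ((-1) ^ i :: complex)"
      by (simp add: power_add)
    have cancel: "u * (r ^ ?D * v) * w * - (T / r ^ ?D) = - u * v * w * T" for u v w
      using r(2) by simp
    show ?thesis
      unfolding x_def Q_def[symmetric] t c sgn cancel s
      by (simp add: power_add mult_ac)
  qed
  have "rhs_term r a k i n = (- 1) ^ n * a ^ (K * n) * r ^ e * (1 + a ^ d * r ^ (L * d * (2 * n + 1)))"
    unfolding e_def d_def by (rule rhs_term_eq[OF k i(2) K_def L_def])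
  then show ?thesis
    unfolding K(3) low high Q_def[symmetric] T_def[symmetric] by (simp add: distrib_left mult.assoc)
qed

lemma sum_split_symmetric:
  fixes f :: "nat \<Rightarrow> 'a::comm_monoid_add"
  shows "(\<Sum>m<2 * n + 1. f m) = f 0 + (\<Sum>i=1..n. f i + f (2 * n + 1 - i))"
proof -
  have "{..<2 * n + 1} = {0} \<union> {1..n} \<union> {n + 1..2 * n}"
    by auto
  then have "(\<Sum>m<2 * n + 1. f m) = f 0 + (\<Sum>i=1..n. f i) + (\<Sum>i=n + 1..2 * n. f i)"
    by (simp add: sum.union_disjoint add.assoc)
  also have "(\<Sum>i=n + 1..2 * n. f i) = (\<Sum>i=1..n. f (2 * n + 1 - i))"
    by (rule sum.reindex_bij_witness[of _ "\<lambda>i. 2 * n + 1 - i" "\<lambda>i. 2 * n + 1 - i"]) auto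
  finally show ?thesis
    by (simp add: sum.distrib add.assoc)
qed

lemma theta_weight_mult_theta_prod:
  fixes r a :: complex
  assumes r: "norm r < 1" "r \<noteq> 0" and k: "k \<ge> 1" and a: "a \<noteq> 0" and q_def: "q = r\<^sup>2"
  shows "theta_weight (r ^ (4 * k - 1)) n * theta_prod q (a / q ^ n)
    = theta_prod q a * partial_theta_term r a k n"
proof -
  have q: "norm q < 1" "q \<noteq> 0"
    using r by (simp_all add: q_def norm_power power_less_one_iff)
  let ?c = "n choose 2"
  have 1: "theta_prod q a = (-1) ^ n * theta_prod q (a / q ^ n) / ((a / q ^ n) ^ n * q ^ ?c)"
    using theta_prod_mult_power[OF q, of "a / q ^ n" n] a q(2) by simp
  have "4 * k - 1 = (4 * k - 3) + 2"
    using k by simp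
  then have Q: "r ^ (4 * k - 1) = r ^ (4 * k - 3) * q"
    by (simp only: power_add q_def)
  have 2: "theta_weight (r ^ (4 * k - 1)) n = (-1) ^ n * (r ^ ((4 * k - 3) * (?c + n)) * q ^ (?c + n))"
    unfolding Q theta_weight_def power_mult power_add power_mult_distrib by (simp only: mult_ac)
  have 3: "q ^ ?c * (a / q ^ n) ^ n * q ^ (?c + n) = a ^ n"
  proof -
    have "?c + (?c + n) = n * n"
      using choose_two_double[of n] by (simp add: power2_eq_square)
    then have "q ^ ?c * q ^ (?c + n) = (q ^ n) ^ n"
      by (simp only: power_add[symmetric] power_mult[symmetric])
    then show ?thesis
      using q(2) by (simp add: power_divide mult.commute mult.left_commute)
  qed
  have "theta_prod q (a / q ^ n) = (-1) ^ n * theta_prod q a * ((a / q ^ n) ^ n * q ^ ?c)"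
    unfolding 1 using a q(2) by simp
  then have "theta_weight (r ^ (4 * k - 1)) n * theta_prod q (a / q ^ n)
      = theta_prod q a * (r ^ ((4 * k - 3) * (?c + n)) * (q ^ ?c * (a / q ^ n) ^ n * q ^ (?c + n)))"
    unfolding 2 by simp
  also have "\<dots> = theta_prod q a * partial_theta_term r a k n"
    unfolding 3 partial_theta_term_eq[OF k] by (simp add: mult.commute)
  finally show ?thesis .
qed

theorem theorem1p3:
  fixes q r a :: complex and k :: nat
  assumes "0 < norm q" and "norm q < 1"
    and "a \<noteq> 0" and "a \<notin> {q powi m | m :: int. True}"
    and "r ^ 2 = q"
    and "k \<ge> 1"
  shows "summable (lhs_term q r a k)
    \<and> summable (partial_theta_term r a k)
    \<and> (\<forall>i\<in>{1..2*k-1}. summable (rhs_term r a k i))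
    \<and> (\<Sum>n. lhs_term q r a k n)
      = (\<Sum>n. partial_theta_term r a k n)
        + (\<Sum>i=1..2*k-1. (- 1) ^ (i + 1) * a ^ i * q ^ (i choose 2) * prod_factor q r a k i
             * (\<Sum>n. rhs_term r a k i n))"
proof -
  have q_def: "q = r\<^sup>2"
    using assms by simp
  have r: "norm r < 1" "r \<noteq> 0"
    using assms(1,2) by (auto simp: q_def norm_power power_less_one_iff)
  have q: "norm q < 1" "q \<noteq> 0"
    using assms by auto
  note a = \<open>a \<noteq> 0\<close> and k = \<open>k \<ge> 1\<close>
  have a1: "a * q ^ j \<noteq> 1" for j
  proof
    assume "a * q ^ j = 1"
    then have "a = q powi (- int j)"
      using q by (simp add: power_int_minus field_simps)
    then show False
      using assms(4) by blast
  qed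
  have a2: "q / a * q ^ j \<noteq> 1" for j
  proof
    assume "q / a * q ^ j = 1"
    then have "a = q powi int (Suc j)"
      using a unfolding power_int_of_nat by (simp add: field_simps)
    then show False
      using assms(4) by blast
  qed
  define K where "K = 4 * k - 1"
  define P where "P = theta_prod q a"
  have "qpoch_inf a q \<noteq> 0" "qpoch_inf (q / a) q \<noteq> 0"
    unfolding qpoch_inf_eq_0_iff[OF q(1)] using a1 a2 by blast+
  then have P: "P \<noteq> 0"
    by (simp add: P_def theta_prod_def qpoch_inf_q_nonzero[OF q(1)])
  have P': "qpoch_inf q q * qpoch_inf a q * qpoch_inf (q / a) q = P"
    by (simp add: P_def theta_prod_def)
  let ?w = "theta_weight (r ^ K)"
  let ?x = "\<lambda>m. (-1) ^ m * q ^ (m choose 2) * a ^ m * theta_prod (r ^ K) (q ^ m)"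
  obtain S1 where S1: "(\<lambda>N. P * lhs_term q r a k N) sums S1"
    "(\<lambda>n. ?w n * (ptheta q (a * q * q ^ n) + ptheta q (q / a * q ^ n) - 1)) sums S1"
    using lhs_sums[OF r k a a1 a2 q_def] unfolding P' K_def by blast
  have "K \<ge> 3"
    using k by (simp add: K_def)
  then obtain S2 where S2: "(\<lambda>n. ?w n * (ptheta q (a / q ^ n) - ptheta q (a * q * q ^ n))) sums S2" "?x sums S2"
    using theta_swap[OF r _ a q_def] by blast
  have "(\<lambda>n. P * partial_theta_term r a k n) sums (S1 + S2)"
  proof -
    have "?w n * (ptheta q (a * q * q ^ n) + ptheta q (q / a * q ^ n) - 1)
        + ?w n * (ptheta q (a / q ^ n) - ptheta q (a * q * q ^ n)) = P * partial_theta_term r a k n" for n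
    proof -
      have "ptheta q (a * q * q ^ n) + ptheta q (q / a * q ^ n) - 1 + (ptheta q (a / q ^ n) - ptheta q (a * q * q ^ n))
          = theta_prod q (a / q ^ n)"
        using theta_prod_eq_ptheta[OF q, of "a / q ^ n"] a q(2) by simp
      then show ?thesis
        unfolding distrib_left[symmetric]
        using theta_weight_mult_theta_prod[OF r k a q_def, of n] by (simp add: K_def P_def)
    qed
    with sums_add[OF S1(2) S2(1)] show ?thesis
      by simp
  qed
  from sums_divide[OF this, of P] P have partial: "partial_theta_term r a k sums ((S1 + S2) / P)"
    by simp
  from sums_divide[OF S1(1), of P] P have lhs: "lhs_term q r a k sums (S1 / P)"
    by simp
  have rhs: "summable (rhs_term r a k i)" if "i \<in> {1..2*k-1}" for i
    using summable_rhs_term[OF r(1) k] that by simp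
  define c where "c i = (- 1) ^ (i + 1) * a ^ i * q ^ (i choose 2) * prod_factor q r a k i" for i
  have c: "- P * c i = (- 1) ^ i * a ^ i * q ^ (i choose 2) * theta_prod (r ^ K) (q ^ i)" if "i \<in> {1..2*k-1}" for i
  proof -
    have "2 * kappa k = real K"
      using two_kappa[OF k] by (simp add: K_def)
    moreover have "half_pow r (kappa k - real i) = r ^ (K - 2 * i)"
      using two_kappa[OF k] that by (intro half_pow_eq_power) (auto simp: K_def of_nat_diff)
    moreover have "r ^ K / q ^ i = r ^ (K - 2 * i)"
    proof -
      have "K = (K - 2 * i) + 2 * i"
        using that k by (auto simp: K_def)
      then have "r ^ K = r ^ (K - 2 * i) * q ^ i"
        unfolding q_def by (metis power_add power_mult)
      then show ?thesis
        using q by simp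
    qed
    ultimately have "prod_factor q r a k i = theta_prod (r ^ K) (q ^ i) / P"
      unfolding prod_factor_def Let_def P'
      by (simp add: half_pow_eq_power theta_prod_def)
    then show ?thesis
      using P by (simp add: c_def)
  qed
  have "(\<lambda>j. \<Sum>m\<in>{j * K..<j * K + K}. ?x m) sums S2"
    using S2(2) \<open>K \<ge> 3\<close> by (intro sums_group) auto
  moreover have "(\<Sum>m\<in>{j * K..<j * K + K}. ?x m) = (\<Sum>i=1..2*k-1. - P * c i * rhs_term r a k i j)" for j
  proof -
    have K2: "K = 2 * (2 * k - 1) + 1"
      using k by (simp add: K_def)
    have x0: "?x (j * K + 0) = 0"
    proof -
      have "q ^ (j * K + 0) = 1 * (r ^ K) ^ (2 * j)"
        by (simp add: q_def mult_ac flip: power_mult)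
      moreover have "norm (r ^ K) < 1" "r ^ K \<noteq> 0"
        using r \<open>K \<ge> 3\<close> by (simp_all add: norm_power power_less_one_iff)
      moreover from this have "theta_prod (r ^ K) 1 = 0"
        using qpoch_inf_split[of "r ^ K" 1 1] by (simp add: theta_prod_def qfac_def)
      ultimately have "theta_prod (r ^ K) (q ^ (j * K + 0)) = 0"
        using theta_prod_mult_power[of "r ^ K" 1 "2 * j"] by (simp only:) simp
      then show ?thesis
        by simp
    qed
    have "(\<Sum>m\<in>{j * K..<j * K + K}. ?x m) = (\<Sum>m<K. ?x (j * K + m))"
      by (rule sum.reindex_bij_witness[of _ "\<lambda>m. j * K + m" "\<lambda>m. m - j * K"]) auto
    also have "\<dots> = ?x (j * K + 0) + (\<Sum>i=1..2*k-1. ?x (j * K + i) + ?x (j * K + (K - i)))"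
      using sum_split_symmetric[of "\<lambda>m. ?x (j * K + m)" "2 * k - 1"] unfolding K2[symmetric] .
    also have "\<dots> = (\<Sum>i=1..2*k-1. - P * c i * rhs_term r a k i j)"
      unfolding x0 add_0_left
    proof (intro sum.cong refl)
      fix i assume i: "i \<in> {1..2*k-1}"
      then have "1 \<le> i" "i \<le> 2 * k - 1"
        by auto
      from theta_block[OF r k this q_def K_def, where a = a and n = j]
      show "?x (j * K + i) + ?x (j * K + (K - i)) = - P * c i * rhs_term r a k i j"
        unfolding c[OF i] .
    qed
    finally show ?thesis .
  qed
  ultimately have "(\<lambda>j. \<Sum>i=1..2*k-1. - P * c i * rhs_term r a k i j) sums S2"
    by (simp only:)
  moreover have "(\<lambda>j. \<Sum>i=1..2*k-1. - P * c i * rhs_term r a k i j)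
      sums (\<Sum>i=1..2*k-1. - P * c i * (\<Sum>n. rhs_term r a k i n))"
    by (intro sums_sum sums_mult summable_sums rhs)
  ultimately have "S2 = (\<Sum>i=1..2*k-1. - P * c i * (\<Sum>n. rhs_term r a k i n))"
    by (rule sums_unique2)
  also have "\<dots> = - P * (\<Sum>i=1..2*k-1. c i * (\<Sum>n. rhs_term r a k i n))"
    by (simp add: sum_distrib_left mult.assoc)
  finally have S2_eq: "S2 = - P * (\<Sum>i=1..2*k-1. c i * (\<Sum>n. rhs_term r a k i n))" .
  have main: "S1 / P = (S1 + S2) / P + (\<Sum>i=1..2*k-1. c i * (\<Sum>n. rhs_term r a k i n))"
    unfolding S2_eq add_divide_distrib using P by simp
  show ?thesis
    using sums_summable[OF lhs] sums_summable[OF partial] rhs main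
    unfolding c_def sums_unique[OF lhs, symmetric] sums_unique[OF partial, symmetric] by blast
qed

end
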